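(* Let $t_0\in I$ and let $f\in\mathcal R'$ satisfy $f=0$ for $t<t_0$. Then there exists a solution $x\in\mathcal R'$ of the equation $x'=f$ such that $x=0$ for $t<t_0$.
   Context: $I=(a,b)\subset\mathbf R$ is an open interval (e.g. $I=\mathbf R$), $\mathbf N_0=\mathbf N\cup\{0\}$; functions are identified when equal almost everywhere. $\mathbb G$ is the algebra of essentially bounded $g:I\to\mathbf C$ possessing both limits $g(t\pm)=\operatorname{ess\,lim}_{s\to t\pm}g(s)$ at every $t\in I$; $\sigma_t(g):=g(t+)-g(t-)$. $\mathbb G^\infty$ is the algebra of $g\in\mathbb G$ such that for every $k\in\mathbf N$ there is $g^{(k)}\in\mathbb G$ with $g^{(k)}(t\pm)=\operatorname{ess\,lim}_{s\to t\pm}\frac{g^{(k-1)}(s)-g^{(k-1)}(t\pm)}{s-t}$ for all $t\in I$ ($g^{(0)}=g$), with the norms $\|g\|_k=\max_{0\le i\le k}\|g^{(i)}\|_{L_\infty}$, $k\in\mathbf N_0$. For $g\in\mathbb G$, $\operatorname{supp}(g)$ is the closure in $I$ of $\{t: g(t-)\ne0\text{ or }g(t+)\ne0\}$. $\mathcal R$ is the space of $\varphi\in\mathbb G^\infty$ with compact support in $I$, with the locally convex inductive limit topology of the countably normed spaces $\{\varphi\in\mathbb G^\infty:\varphi=0\text{ outside }J\}$ (norms $\|\cdot\|_k$), $J$ running over bounded subintervals with $\bar J\subset I$. $\mathcal R'$ is the space of continuous linear functionals $f:\mathcal R\to\mathbf C$, $\varphi\mapsto(f,\varphi)$. Derivative: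 let $\mathbb C$ be the bounded continuous functions on $I$; $\mathbb F_k\subset\mathbb G^\infty$ is the set of $g$ with $g^{(i)}\in\mathbb C$ for all $i\ne k$ and $g^{(k)}$ piecewise continuous (locally finitely many discontinuities); $\mathbb F$ is the linear span of all $\mathbb F_k$, $k\in\mathbf N_0$; $\mathcal R_F=\mathcal R\cap\mathbb F$. $\Delta\subset\mathcal R'$ is the set of $g\in\mathcal R'$ for which there is $c:I\to\mathbf C$ with $(g,\varphi)=\sum_{t\in I}c(t)\sigma_t(\varphi)$ for all $\varphi\in\mathcal R_F$ (a finite sum). For $f\in\mathcal R'$ let $(\frac{df}{dt},\varphi):=-(f,\varphi')$; a derivative of $f$ is any element $f'$ of $D(f):=\frac{df}{dt}+\Delta$ (differentiation is multivalued). "$f=0$ for $t<t_0$" means $(f,\varphi)=0$ for all $\varphi\in\mathcal R$ with $\operatorname{supp}(\varphi)\subset(a,t_0)$. A solution of $x'=f$ is $x\in\mathcal R'$ having some derivative $x'\in D(x)$ with $(x',\varphi)=(f,\varphi)$ for all $\varphi\in\mathcal R$, i.e. $f\in D(x)$. *)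

theory Defs
  imports "HOL-Analysis.Analysis" "HOL-Probability.Essential_Supremum"
begin

text \<open>
  The interval is a parameter \<open>I\<close>.  A class of functions on \<open>I\<close> modulo equality almost
  everywhere is represented by its members, which are total functions whose values outside \<open>I\<close>
  play no role; every notion below is invariant under changing the representative.
\<close>

definition ae_eq_on :: "real set \<Rightarrow> (real \<Rightarrow> complex) \<Rightarrow> (real \<Rightarrow> complex) \<Rightarrow> bool" where
  "ae_eq_on I g h \<longleftrightarrow> (AE t in lebesgue_on I. g t = h t)"


section \<open>Essential one-sided limits and the algebras of regulated functions\<close>

text \<open>
  Taking the infimum with \<open>ae_filter lebesgue\<close> allows a null set to be discarded, so convergence
  along these filters is convergence of the essential limit.
\<close>

definition ess_at_left :: "real \<Rightarrow> real filter" where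
  "ess_at_left t = inf (at_left t) (ae_filter lebesgue)"

definition ess_at_right :: "real \<Rightarrow> real filter" where
  "ess_at_right t = inf (at_right t) (ae_filter lebesgue)"

definition left_val :: "(real \<Rightarrow> complex) \<Rightarrow> real \<Rightarrow> complex" where
  "left_val g t = Lim (ess_at_left t) g"

definition right_val :: "(real \<Rightarrow> complex) \<Rightarrow> real \<Rightarrow> complex" where
  "right_val g t = Lim (ess_at_right t) g"

definition jump :: "real \<Rightarrow> (real \<Rightarrow> complex) \<Rightarrow> complex" where
  "jump t g = right_val g t - left_val g t"

definition Linf_norm :: "real set \<Rightarrow> (real \<Rightarrow> complex) \<Rightarrow> real" where
  "Linf_norm I g = real_of_ereal (esssup (lebesgue_on I) (\<lambda>t. ereal (cmod (g t))))"

definition GG :: "real set \<Rightarrow> (real \<Rightarrow> complex) set" where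
  "GG I = {g. g \<in> borel_measurable (lebesgue_on I) \<and>
              esssup (lebesgue_on I) (\<lambda>t. ereal (cmod (g t))) < \<infinity> \<and>
              (\<forall>t\<in>I. (\<exists>l. (g \<longlongrightarrow> l) (ess_at_left t)) \<and> (\<exists>l. (g \<longlongrightarrow> l) (ess_at_right t)))}"

definition is_gderiv :: "real set \<Rightarrow> (real \<Rightarrow> complex) \<Rightarrow> (real \<Rightarrow> complex) \<Rightarrow> bool" where
  "is_gderiv I g h \<longleftrightarrow> h \<in> GG I \<and>
     (\<forall>t\<in>I. ((\<lambda>s. (g s - left_val g t) / complex_of_real (s - t)) \<longlongrightarrow> left_val h t) (ess_at_left t) \<and>
            ((\<lambda>s. (g s - right_val g t) / complex_of_real (s - t)) \<longlongrightarrow> right_val h t) (ess_at_right t))"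

text \<open>
  The derivative is unique up to equality almost everywhere, because an element of \<open>GG I\<close> is
  determined almost everywhere by its one-sided limits; \<open>gderiv\<close> picks a representative.
\<close>

definition gderiv :: "real set \<Rightarrow> (real \<Rightarrow> complex) \<Rightarrow> (real \<Rightarrow> complex)" where
  "gderiv I g = (SOME h. is_gderiv I g h)"

abbreviation gderivs :: "real set \<Rightarrow> nat \<Rightarrow> (real \<Rightarrow> complex) \<Rightarrow> (real \<Rightarrow> complex)" where
  "gderivs I k g \<equiv> (gderiv I ^^ k) g"

definition GG_inf :: "real set \<Rightarrow> (real \<Rightarrow> complex) set" where
  "GG_inf I = {g \<in> GG I. \<exists>d :: nat \<Rightarrow> real \<Rightarrow> complex. d 0 = g \<and> (\<forall>k. is_gderiv I (d k) (d (Suc k)))}"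

definition knorm :: "real set \<Rightarrow> nat \<Rightarrow> (real \<Rightarrow> complex) \<Rightarrow> real" where
  "knorm I k g = Max ((\<lambda>i. Linf_norm I (gderivs I i g)) ` {0..k})"

definition gsupp :: "real set \<Rightarrow> (real \<Rightarrow> complex) \<Rightarrow> real set" where
  "gsupp I g = I \<inter> closure {t \<in> I. left_val g t \<noteq> 0 \<or> right_val g t \<noteq> 0}"


section \<open>Test functions and their topology\<close>

definition RR :: "real set \<Rightarrow> (real \<Rightarrow> complex) set" where
  "RR I = {\<phi> \<in> GG_inf I. compact (gsupp I \<phi>)}"

definition inner_interval :: "real set \<Rightarrow> real set \<Rightarrow> bool" where
  "inner_interval I J \<longleftrightarrow> is_interval J \<and> bounded J \<and> closure J \<subseteq> I"

definition RR_on :: "real set \<Rightarrow> real set \<Rightarrow> (real \<Rightarrow> complex) set" where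
  "RR_on I J = {\<phi> \<in> GG_inf I. AE t in lebesgue_on I. t \<notin> J \<longrightarrow> \<phi> t = 0}"

definition abs_convex :: "(real \<Rightarrow> complex) set \<Rightarrow> bool" where
  "abs_convex V \<longleftrightarrow> V \<noteq> {} \<and>
     (\<forall>x\<in>V. \<forall>y\<in>V. \<forall>\<alpha> \<beta>. cmod \<alpha> + cmod \<beta> \<le> 1 \<longrightarrow> (\<lambda>t. \<alpha> * x t + \<beta> * y t) \<in> V)"

text \<open>
  The norms \<open>knorm I k\<close> increase with \<open>k\<close>, so single balls form a base of zero neighbourhoods
  of the countably normed space \<open>RR_on I J\<close>.  The absolutely convex sets meeting each
  \<open>RR_on I J\<close> in a zero neighbourhood form a base of zero neighbourhoods of the locally convex
  inductive limit, i.e. of the finest locally convex topology for which all inclusions are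
  continuous.
\<close>

definition RR_nhd0 :: "real set \<Rightarrow> (real \<Rightarrow> complex) set \<Rightarrow> bool" where
  "RR_nhd0 I V \<longleftrightarrow> V \<subseteq> RR I \<and> abs_convex V \<and>
     (\<forall>J. inner_interval I J \<longrightarrow> (\<exists>k. \<exists>\<epsilon>>0. {\<phi> \<in> RR_on I J. knorm I k \<phi> < \<epsilon>} \<subseteq> V))"

definition RR_open :: "real set \<Rightarrow> (real \<Rightarrow> complex) set \<Rightarrow> bool" where
  "RR_open I U \<longleftrightarrow> U \<subseteq> RR I \<and>
     (\<forall>\<phi>\<in>U. \<exists>V. RR_nhd0 I V \<and> (\<forall>\<psi>\<in>V. (\<lambda>t. \<phi> t + \<psi> t) \<in> U))"

definition RR_top :: "real set \<Rightarrow> (real \<Rightarrow> complex) topology" where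
  "RR_top I = topology (RR_open I)"


section \<open>Distributions and the multivalued derivative\<close>

text \<open>
  Only the values of a functional on \<open>RR I\<close> matter.  The second clause says that it is well
  defined on classes modulo equality almost everywhere.
\<close>

definition RR_dual :: "real set \<Rightarrow> ((real \<Rightarrow> complex) \<Rightarrow> complex) set" where
  "RR_dual I = {f.
     (\<forall>\<phi>\<in>RR I. \<forall>\<psi>\<in>RR I. \<forall>\<alpha> \<beta>. f (\<lambda>t. \<alpha> * \<phi> t + \<beta> * \<psi> t) = \<alpha> * f \<phi> + \<beta> * f \<psi>) \<and>
     (\<forall>\<phi>\<in>RR I. \<forall>\<psi>\<in>RR I. ae_eq_on I \<phi> \<psi> \<longrightarrow> f \<phi> = f \<psi>) \<and>
     continuous_map (RR_top I) euclidean f}"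

definition is_BC :: "real set \<Rightarrow> (real \<Rightarrow> complex) \<Rightarrow> bool" where
  "is_BC I g \<longleftrightarrow> (\<exists>h. ae_eq_on I g h \<and> continuous_on I h \<and> bounded (h ` I))"

definition is_PC :: "real set \<Rightarrow> (real \<Rightarrow> complex) \<Rightarrow> bool" where
  "is_PC I g \<longleftrightarrow> (\<exists>h S. ae_eq_on I g h \<and> S \<subseteq> I \<and>
     (\<forall>K. compact K \<and> K \<subseteq> I \<longrightarrow> finite (S \<inter> K)) \<and> continuous_on (I - S) h)"

definition FF_k :: "real set \<Rightarrow> nat \<Rightarrow> (real \<Rightarrow> complex) set" where
  "FF_k I k = {g \<in> GG_inf I. (\<forall>i. i \<noteq> k \<longrightarrow> is_BC I (gderivs I i g)) \<and> is_PC I (gderivs I k g)}"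

definition FF :: "real set \<Rightarrow> (real \<Rightarrow> complex) set" where
  "FF I = {g. \<exists>(n::nat) (c :: nat \<Rightarrow> complex) h. (\<forall>j<n. h j \<in> (\<Union>k. FF_k I k)) \<and>
              ae_eq_on I g (\<lambda>t. \<Sum>j<n. c j * h j t)}"

definition RR_F :: "real set \<Rightarrow> (real \<Rightarrow> complex) set" where
  "RR_F I = RR I \<inter> FF I"

text \<open>
  An element of \<open>RR_F I\<close> has only finitely many jumps, so the index set below is finite.
\<close>

definition Delta :: "real set \<Rightarrow> ((real \<Rightarrow> complex) \<Rightarrow> complex) set" where
  "Delta I = {g \<in> RR_dual I. \<exists>c :: real \<Rightarrow> complex. \<forall>\<phi>\<in>RR_F I.
     g \<phi> = (\<Sum>t\<in>{t \<in> I. jump t \<phi> \<noteq> 0}. c t * jump t \<phi>)}"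

definition ddt :: "real set \<Rightarrow> ((real \<Rightarrow> complex) \<Rightarrow> complex) \<Rightarrow> ((real \<Rightarrow> complex) \<Rightarrow> complex)" where
  "ddt I f \<phi> = - f (gderiv I \<phi>)"

definition derivatives :: "real set \<Rightarrow> ((real \<Rightarrow> complex) \<Rightarrow> complex) \<Rightarrow> ((real \<Rightarrow> complex) \<Rightarrow> complex) set" where
  "derivatives I f = {f' \<in> RR_dual I. \<exists>\<delta>\<in>Delta I. \<forall>\<phi>\<in>RR I. f' \<phi> = ddt I f \<phi> + \<delta> \<phi>}"

definition vanishes_before :: "real set \<Rightarrow> real \<Rightarrow> ((real \<Rightarrow> complex) \<Rightarrow> complex) \<Rightarrow> bool" where
  "vanishes_before I t\<^sub>0 f \<longleftrightarrow> (\<forall>\<phi>\<in>RR I. gsupp I \<phi> \<subseteq> I \<inter> {..<t\<^sub>0} \<longrightarrow> f \<phi> = 0)"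

definition is_solution :: "real set \<Rightarrow> ((real \<Rightarrow> complex) \<Rightarrow> complex) \<Rightarrow> ((real \<Rightarrow> complex) \<Rightarrow> complex) \<Rightarrow> bool" where
  "is_solution I f x \<longleftrightarrow> x \<in> RR_dual I \<and> (\<exists>x'\<in>derivatives I x. \<forall>\<phi>\<in>RR I. x' \<phi> = f \<phi>)"


section \<open>The open sets form a topology with underlying set \<open>RR I\<close>\<close>

lemma knorm_mono: "k \<le> m \<Longrightarrow> knorm I k g \<le> knorm I m g"
  unfolding knorm_def by (rule Max_mono) auto

lemma RR_nhd0_zero:
  assumes "RR_nhd0 I V" shows "(\<lambda>t. 0) \<in> V"
proof -
  from assms obtain x where "x \<in> V" and *: "abs_convex V"
    unfolding RR_nhd0_def abs_convex_def by auto
  then have "(\<lambda>t. 0 * x t + 0 * x t) \<in> V"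
    unfolding abs_convex_def by (metis add_0 norm_zero zero_le_one)
  then show ?thesis by simp
qed

lemma RR_nhd0_Int:
  assumes "RR_nhd0 I V" "RR_nhd0 I W" shows "RR_nhd0 I (V \<inter> W)"
proof -
  have "(\<lambda>t. 0) \<in> V \<inter> W" using assms RR_nhd0_zero by auto
  then have "abs_convex (V \<inter> W)"
    using assms unfolding RR_nhd0_def abs_convex_def by blast
  moreover have "\<exists>k. \<exists>\<epsilon>>0. {\<phi> \<in> RR_on I J. knorm I k \<phi> < \<epsilon>} \<subseteq> V \<inter> W"
    if J: "inner_interval I J" for J
  proof -
    obtain k e where 1: "e > 0" "{\<phi> \<in> RR_on I J. knorm I k \<phi> < e} \<subseteq> V"
      using assms(1) J unfolding RR_nhd0_def by blast
    obtain m d where 2: "d > 0" "{\<phi> \<in> RR_on I J. knorm I m \<phi> < d} \<subseteq> W"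
      using assms(2) J unfolding RR_nhd0_def by blast
    have "{\<phi> \<in> RR_on I J. knorm I (max k m) \<phi> < min e d} \<subseteq> V \<inter> W"
    proof
      fix \<phi> assume "\<phi> \<in> {\<phi> \<in> RR_on I J. knorm I (max k m) \<phi> < min e d}"
      moreover have "knorm I k \<phi> \<le> knorm I (max k m) \<phi>" "knorm I m \<phi> \<le> knorm I (max k m) \<phi>"
        by (simp_all add: knorm_mono)
      ultimately show "\<phi> \<in> V \<inter> W" using 1 2 by auto
    qed
    then show ?thesis using 1 2 by (metis min_less_iff_conj)
  qed
  ultimately show ?thesis using assms unfolding RR_nhd0_def by blast
qed

lemma istopology_RR_open: "istopology (RR_open I)"
  unfolding istopology_def
proof (intro conjI allI impI)
  fix S T assume S: "RR_open I S" and T: "RR_open I T"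
  show "RR_open I (S \<inter> T)"
    unfolding RR_open_def
  proof (intro conjI ballI)
    show "S \<inter> T \<subseteq> RR I" using S unfolding RR_open_def by auto
    fix \<phi> assume "\<phi> \<in> S \<inter> T"
    then obtain V W where "RR_nhd0 I V" "\<forall>\<psi>\<in>V. (\<lambda>t. \<phi> t + \<psi> t) \<in> S"
        "RR_nhd0 I W" "\<forall>\<psi>\<in>W. (\<lambda>t. \<phi> t + \<psi> t) \<in> T"
      using S T unfolding RR_open_def by (metis IntE)
    then show "\<exists>V. RR_nhd0 I V \<and> (\<forall>\<psi>\<in>V. (\<lambda>t. \<phi> t + \<psi> t) \<in> S \<inter> T)"
      by (intro exI[of _ "V \<inter> W"]) (auto intro: RR_nhd0_Int)
  qed
next
  fix \<K> assume *: "\<forall>K\<in>\<K>. RR_open I K"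
  show "RR_open I (\<Union>\<K>)"
    unfolding RR_open_def
  proof (intro conjI ballI)
    show "\<Union>\<K> \<subseteq> RR I" using * unfolding RR_open_def by blast
    fix \<phi> assume "\<phi> \<in> \<Union>\<K>"
    then obtain K where "K \<in> \<K>" "\<phi> \<in> K" by auto
    moreover from this obtain V where "RR_nhd0 I V" "\<forall>\<psi>\<in>V. (\<lambda>t. \<phi> t + \<psi> t) \<in> K"
      using * unfolding RR_open_def by meson
    ultimately show "\<exists>V. RR_nhd0 I V \<and> (\<forall>\<psi>\<in>V. (\<lambda>t. \<phi> t + \<psi> t) \<in> \<Union>\<K>)"
      by blast
  qed
qed

lemma openin_RR_top: "openin (RR_top I) U \<longleftrightarrow> RR_open I U"
  unfolding RR_top_def using istopology_RR_open by (simp add: topology_inverse')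

lemma ess_at_left_not_bot: "ess_at_left t \<noteq> bot"
proof
  assume "ess_at_left t = bot"
  then obtain P Q where P: "eventually P (at_left t)" and Q: "AE x in lebesgue. Q x"
    and PQ: "\<And>x. P x \<Longrightarrow> Q x \<Longrightarrow> False"
    unfolding ess_at_left_def trivial_limit_def eventually_inf by blast
  obtain b where b: "b < t" "\<And>y. b < y \<Longrightarrow> y < t \<Longrightarrow> P y"
    using P unfolding eventually_at_left_field by blast
  obtain N where "negligible N" "{x. \<not> Q x} \<subseteq> N"
    using Q unfolding eventually_ae_filter_negligible by blast
  moreover from this have "{b<..<t} \<subseteq> N" using b PQ by fastforce
  ultimately have "negligible {b<..<t}" using negligible_subset by blast
  then show False using b open_not_negligible[of "{b<..<t}"] by auto
qed

lemma ess_at_right_not_bot: "ess_at_right t \<noteq> bot"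
proof
  assume "ess_at_right t = bot"
  then obtain P Q where P: "eventually P (at_right t)" and Q: "AE x in lebesgue. Q x"
    and PQ: "\<And>x. P x \<Longrightarrow> Q x \<Longrightarrow> False"
    unfolding ess_at_right_def trivial_limit_def eventually_inf by blast
  obtain b where b: "t < b" "\<And>y. t < y \<Longrightarrow> y < b \<Longrightarrow> P y"
    using P unfolding eventually_at_right_field by blast
  obtain N where "negligible N" "{x. \<not> Q x} \<subseteq> N"
    using Q unfolding eventually_ae_filter_negligible by blast
  moreover from this have "{t<..<b} \<subseteq> N" using b PQ by fastforce
  ultimately have "negligible {t<..<b}" using negligible_subset by blast
  then show False using b open_not_negligible[of "{t<..<b}"] by auto
qed

lemma GG_tendsto_left: "g \<in> GG I \<Longrightarrow> t \<in> I \<Longrightarrow> (g \<longlongrightarrow> left_val g t) (ess_at_left t)"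
  unfolding GG_def left_val_def using tendsto_Lim[OF ess_at_left_not_bot] by fastforce

lemma GG_tendsto_right: "g \<in> GG I \<Longrightarrow> t \<in> I \<Longrightarrow> (g \<longlongrightarrow> right_val g t) (ess_at_right t)"
  unfolding GG_def right_val_def using tendsto_Lim[OF ess_at_right_not_bot] by fastforce

lemma left_val_lincomb:
  "g \<in> GG I \<Longrightarrow> h \<in> GG I \<Longrightarrow> t \<in> I \<Longrightarrow>
    left_val (\<lambda>s. \<alpha> * g s + \<beta> * h s) t = \<alpha> * left_val g t + \<beta> * left_val h t"
  unfolding left_val_def[of "\<lambda>s. \<alpha> * g s + \<beta> * h s"]
  by (rule tendsto_Lim[OF ess_at_left_not_bot]) (auto intro!: tendsto_intros GG_tendsto_left)

lemma right_val_lincomb: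
  "g \<in> GG I \<Longrightarrow> h \<in> GG I \<Longrightarrow> t \<in> I \<Longrightarrow>
    right_val (\<lambda>s. \<alpha> * g s + \<beta> * h s) t = \<alpha> * right_val g t + \<beta> * right_val h t"
  unfolding right_val_def[of "\<lambda>s. \<alpha> * g s + \<beta> * h s"]
  by (rule tendsto_Lim[OF ess_at_right_not_bot]) (auto intro!: tendsto_intros GG_tendsto_right)

lemma esssup_less_infinity_iff:
  assumes "g \<in> borel_measurable (lebesgue_on I)"
  shows "esssup (lebesgue_on I) (\<lambda>t. ereal (cmod (g t))) < \<infinity> \<longleftrightarrow>
    (\<exists>C. AE t in lebesgue_on I. cmod (g t) \<le> C)"
proof
  assume *: "esssup (lebesgue_on I) (\<lambda>t. ereal (cmod (g t))) < \<infinity>"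
  then obtain C where C: "esssup (lebesgue_on I) (\<lambda>t. ereal (cmod (g t))) < ereal C"
    using ereal_dense2 by blast
  from esssup_AE[of "\<lambda>t. ereal (cmod (g t))" "lebesgue_on I"]
  have "AE t in lebesgue_on I. cmod (g t) \<le> C"
  proof (rule eventually_mono)
    fix t assume "ereal (cmod (g t)) \<le> esssup (lebesgue_on I) (\<lambda>t. ereal (cmod (g t)))"
    also have "\<dots> \<le> ereal C" using C by simp
    finally show "cmod (g t) \<le> C" by simp
  qed
  then show "\<exists>C. AE t in lebesgue_on I. cmod (g t) \<le> C" by blast
next
  assume "\<exists>C. AE t in lebesgue_on I. cmod (g t) \<le> C"
  then obtain C where "AE t in lebesgue_on I. cmod (g t) \<le> C" by blast
  then have "esssup (lebesgue_on I) (\<lambda>t. ereal (cmod (g t))) \<le> ereal C"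
    using assms by (intro esssup_I) auto
  then show "esssup (lebesgue_on I) (\<lambda>t. ereal (cmod (g t))) < \<infinity>"
    by (rule le_less_trans) simp
qed

lemma GG_lincomb:
  assumes g: "g \<in> GG I" and h: "h \<in> GG I"
  shows "(\<lambda>s. \<alpha> * g s + \<beta> * h s) \<in> GG I"
proof -
  have [measurable]: "g \<in> borel_measurable (lebesgue_on I)" "h \<in> borel_measurable (lebesgue_on I)"
    using g h by (auto simp: GG_def)
  obtain C D where "AE t in lebesgue_on I. cmod (g t) \<le> C" "AE t in lebesgue_on I. cmod (h t) \<le> D"
    using g h esssup_less_infinity_iff[of g I] esssup_less_infinity_iff[of h I]
    unfolding GG_def by blast
  then have "AE t in lebesgue_on I. cmod (\<alpha> * g t + \<beta> * h t) \<le> cmod \<alpha> * C + cmod \<beta> * D"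
  proof eventually_elim
    case (elim t)
    have "cmod (\<alpha> * g t + \<beta> * h t) \<le> cmod \<alpha> * cmod (g t) + cmod \<beta> * cmod (h t)"
      by (metis norm_mult norm_triangle_ineq)
    also have "\<dots> \<le> cmod \<alpha> * C + cmod \<beta> * D"
      using elim by (intro add_mono mult_left_mono) auto
    finally show ?case .
  qed
  moreover have m: "(\<lambda>s. \<alpha> * g s + \<beta> * h s) \<in> borel_measurable (lebesgue_on I)" by measurable
  moreover have "((\<lambda>s. \<alpha> * g s + \<beta> * h s) \<longlongrightarrow> \<alpha> * left_val g t + \<beta> * left_val h t) (ess_at_left t)"
    "((\<lambda>s. \<alpha> * g s + \<beta> * h s) \<longlongrightarrow> \<alpha> * right_val g t + \<beta> * right_val h t) (ess_at_right t)"
    if "t \<in> I" for t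
    by (intro tendsto_add tendsto_mult tendsto_const GG_tendsto_left[OF g that] GG_tendsto_left[OF h that]
        GG_tendsto_right[OF g that] GG_tendsto_right[OF h that])+
  ultimately show ?thesis
    unfolding GG_def using esssup_less_infinity_iff[OF m] by blast
qed

lemma is_gderiv_lincomb:
  assumes g: "g \<in> GG I" "is_gderiv I g g'" and h: "h \<in> GG I" "is_gderiv I h h'"
  shows "is_gderiv I (\<lambda>s. \<alpha> * g s + \<beta> * h s) (\<lambda>s. \<alpha> * g' s + \<beta> * h' s)"
proof -
  have GG': "g' \<in> GG I" "h' \<in> GG I" using g h by (auto simp: is_gderiv_def)
  have split: "(\<alpha> * x + \<beta> * y - (\<alpha> * u + \<beta> * v)) / z = \<alpha> * ((x - u) / z) + \<beta> * ((y - v) / z)"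
    for x y u v z :: complex
    by (simp add: diff_divide_distrib add_divide_distrib algebra_simps)
  show ?thesis
    unfolding is_gderiv_def
  proof (intro conjI ballI)
    show "(\<lambda>s. \<alpha> * g' s + \<beta> * h' s) \<in> GG I" by (rule GG_lincomb[OF GG'])
    fix t assume t: "t \<in> I"
    show "((\<lambda>s. (\<alpha> * g s + \<beta> * h s - left_val (\<lambda>s. \<alpha> * g s + \<beta> * h s) t) / complex_of_real (s - t))
        \<longlongrightarrow> left_val (\<lambda>s. \<alpha> * g' s + \<beta> * h' s) t) (ess_at_left t)"
      unfolding left_val_lincomb[OF g(1) h(1) t] left_val_lincomb[OF GG' t] split
      by (intro tendsto_add tendsto_mult tendsto_const) (use g(2) h(2) t in \<open>unfold is_gderiv_def, blast\<close>)+
    show "((\<lambda>s. (\<alpha> * g s + \<beta> * h s - right_val (\<lambda>s. \<alpha> * g s + \<beta> * h s) t) / complex_of_real (s - t))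
        \<longlongrightarrow> right_val (\<lambda>s. \<alpha> * g' s + \<beta> * h' s) t) (ess_at_right t)"
      unfolding right_val_lincomb[OF g(1) h(1) t] right_val_lincomb[OF GG' t] split
      by (intro tendsto_add tendsto_mult tendsto_const) (use g(2) h(2) t in \<open>unfold is_gderiv_def, blast\<close>)+
  qed
qed

lemma GG_inf_lincomb:
  assumes "g \<in> GG_inf I" "h \<in> GG_inf I"
  shows "(\<lambda>s. \<alpha> * g s + \<beta> * h s) \<in> GG_inf I"
proof -
  obtain d where d: "d 0 = g" "\<And>k. is_gderiv I (d k) (d (Suc k))"
    using assms(1) by (auto simp: GG_inf_def)
  obtain e where e: "e 0 = h" "\<And>k. is_gderiv I (e k) (e (Suc k))"
    using assms(2) by (auto simp: GG_inf_def)
  have "d k \<in> GG I" for k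
    using assms(1) d(1) d(2)[of "k - 1"] by (cases k) (simp_all add: GG_inf_def is_gderiv_def)
  moreover have "e k \<in> GG I" for k
    using assms(2) e(1) e(2)[of "k - 1"] by (cases k) (simp_all add: GG_inf_def is_gderiv_def)
  ultimately have *: "is_gderiv I (\<lambda>s. \<alpha> * d k s + \<beta> * e k s)
      (\<lambda>s. \<alpha> * d (Suc k) s + \<beta> * e (Suc k) s)" for k
    using d(2) e(2) by (intro is_gderiv_lincomb)
  have "(\<lambda>s. \<alpha> * g s + \<beta> * h s) \<in> GG I"
    using assms by (intro GG_lincomb) (simp_all add: GG_inf_def)
  then show ?thesis
    unfolding GG_inf_def
    by (intro CollectI conjI exI[of _ "\<lambda>k s. \<alpha> * d k s + \<beta> * e k s"] allI *)
       (simp_all only: d(1) e(1))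
qed

lemma RR_lincomb:
  assumes "\<phi> \<in> RR I" "\<psi> \<in> RR I"
  shows "(\<lambda>s. \<alpha> * \<phi> s + \<beta> * \<psi> s) \<in> RR I"
proof -
  let ?\<chi> = "\<lambda>s. \<alpha> * \<phi> s + \<beta> * \<psi> s"
  have G: "\<phi> \<in> GG I" "\<psi> \<in> GG I" using assms by (auto simp: RR_def GG_inf_def)
  let ?A = "\<lambda>g. {t \<in> I. left_val g t \<noteq> 0 \<or> right_val g t \<noteq> 0}"
  have "?A ?\<chi> \<subseteq> ?A \<phi> \<union> ?A \<psi>"
    using G by (auto simp: left_val_lincomb right_val_lincomb)
  then have "closure (?A ?\<chi>) \<subseteq> closure (?A \<phi>) \<union> closure (?A \<psi>)"
    using closure_mono[of "?A ?\<chi>" "?A \<phi> \<union> ?A \<psi>"] by (simp only: closure_Un)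
  then have "gsupp I ?\<chi> = (gsupp I \<phi> \<union> gsupp I \<psi>) \<inter> closure (?A ?\<chi>)"
    unfolding gsupp_def by blast
  moreover have "compact ((gsupp I \<phi> \<union> gsupp I \<psi>) \<inter> closure (?A ?\<chi>))"
    using assms by (intro compact_Int_closed compact_Un) (auto simp: RR_def)
  ultimately show ?thesis
    using assms by (simp add: RR_def GG_inf_lincomb)
qed

lemma left_val_eq_0:
  assumes "eventually P (at_left t)" "AE s in lebesgue. P s \<longrightarrow> g s = 0"
  shows "left_val g t = 0"
proof -
  have "eventually (\<lambda>s. g s = 0) (ess_at_left t)"
    unfolding ess_at_left_def eventually_inf using assms by blast
  then show ?thesis
    unfolding left_val_def by (intro tendsto_Lim ess_at_left_not_bot tendsto_eventually)
qed

lemma right_val_eq_0: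
  assumes "eventually P (at_right t)" "AE s in lebesgue. P s \<longrightarrow> g s = 0"
  shows "right_val g t = 0"
proof -
  have "eventually (\<lambda>s. g s = 0) (ess_at_right t)"
    unfolding ess_at_right_def eventually_inf using assms by blast
  then show ?thesis
    unfolding right_val_def by (intro tendsto_Lim ess_at_right_not_bot tendsto_eventually)
qed

lemma RR_on_subset_RR:
  assumes "open I" "inner_interval I J" shows "RR_on I J \<subseteq> RR I"
proof
  fix \<phi> assume \<phi>: "\<phi> \<in> RR_on I J"
  have "I \<in> sets lebesgue" using \<open>open I\<close> by auto
  moreover have "AE s in lebesgue_on I. s \<notin> J \<longrightarrow> \<phi> s = 0"
    using \<phi> by (simp add: RR_on_def)
  ultimately have "AE s in lebesgue. s \<in> I \<longrightarrow> s \<notin> J \<longrightarrow> \<phi> s = 0"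
    by (simp add: AE_restrict_space_iff)
  then have ae: "AE s in lebesgue. s \<in> I - closure J \<longrightarrow> \<phi> s = 0"
    by (rule eventually_mono) (use closure_subset[of J] in blast)
  let ?A = "{t \<in> I. left_val \<phi> t \<noteq> 0 \<or> right_val \<phi> t \<noteq> 0}"
  have "?A \<subseteq> closure J"
  proof (rule ccontr)
    assume "\<not> ?A \<subseteq> closure J"
    then obtain t where t: "t \<in> ?A" "t \<in> I - closure J" by blast
    have "open (I - closure J)" using \<open>open I\<close> by auto
    then have ev: "eventually (\<lambda>s. s \<in> I - closure J) (at t)"
      using t(2) eventually_at_topological by blast
    then have "left_val \<phi> t = 0" "right_val \<phi> t = 0"
      using left_val_eq_0[OF _ ae] right_val_eq_0[OF _ ae] by (simp_all only: eventually_at_split)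
    with t show False by auto
  qed
  then have "closure ?A \<subseteq> closure J" by (metis closure_closure closure_mono)
  then have "gsupp I \<phi> = closure J \<inter> closure ?A"
    using assms(2) unfolding gsupp_def inner_interval_def by blast
  moreover have "compact (closure J)" using assms(2) by (auto simp: inner_interval_def)
  ultimately have "compact (gsupp I \<phi>)" by auto
  then show "\<phi> \<in> RR I" using \<phi> by (auto simp: RR_def RR_on_def)
qed

lemma topspace_RR_top:
  assumes "open I" shows "topspace (RR_top I) = RR I"
proof
  show "topspace (RR_top I) \<subseteq> RR I"
    by (auto simp: topspace_def openin_RR_top RR_open_def)
  show "RR I \<subseteq> topspace (RR_top I)"
  proof (cases "RR I = {}")
    case False
    have "abs_convex (RR I)" using False by (auto simp: abs_convex_def RR_lincomb)
    moreover have "\<exists>k. \<exists>\<epsilon>>0. {\<phi> \<in> RR_on I J. knorm I k \<phi> < \<epsilon>} \<subseteq> RR I" if "inner_interval I J" for J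
      using RR_on_subset_RR[OF assms that] by (intro exI[of _ 0] exI[of _ 1]) auto
    ultimately have "RR_nhd0 I (RR I)" by (simp add: RR_nhd0_def)
    moreover have "(\<lambda>t. \<phi> t + \<psi> t) \<in> RR I" if "\<phi> \<in> RR I" "\<psi> \<in> RR I" for \<phi> \<psi>
      using RR_lincomb[OF that, of 1 1] by simp
    ultimately have "RR_open I (RR I)" unfolding RR_open_def by blast
    then show ?thesis by (simp add: openin_subset openin_RR_top)
  qed auto
qed

end

theory Submission
  imports Defs
begin

text \<open>
  Fix \<open>r < t\<^sub>0\<close> in \<open>I\<close>.  For a test function \<open>\<phi>\<close> let \<open>P \<phi>\<close> be its primitive from the left end of \<open>I\<close>,
  made compactly supported by subtracting \<open>\<integral>\<phi>\<close> times the unit step at \<open>r\<close>, and put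
  \<open>(x, \<phi>) = - (f, P \<phi>)\<close>.  The discrepancy between \<open>f\<close> and the distributional derivative of \<open>x\<close> is
  \<open>\<phi> \<mapsto> (f, \<phi> - P \<phi>')\<close>.  If \<open>\<phi>\<close> has finitely many jumps, \<open>\<phi> - P \<phi>'\<close> has derivative zero, is constant
  between the jumps and has compact support, so it is the sum over \<open>s\<close> of \<open>\<sigma>\<^sub>s(\<phi>)\<close> times the
  difference of the steps at \<open>s\<close> and at \<open>r\<close>.  Hence the discrepancy is in \<open>\<Delta>\<close>, with
  \<open>c(s)\<close> the value of \<open>f\<close> at that difference.  As \<open>r < t\<^sub>0\<close>, \<open>P\<close> preserves the
  test functions supported in \<open>t < t\<^sub>0\<close>, so \<open>x\<close> inherits the vanishing of \<open>f\<close>.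
\<close>


section \<open>Essential one-sided limits\<close>

lemma AE_lebesgue_on_iff:
  assumes "open (I :: real set)"
  shows "(AE t in lebesgue_on I. P t) \<longleftrightarrow> (AE t in lebesgue. t \<in> I \<longrightarrow> P t)"
  using assms by (intro AE_restrict_space_iff) auto

text \<open>The neighbourhood and the exceptional null set behind the filter are merged into one
  almost-everywhere statement on an interval. This is the form in which essential limits are proved
  and used below.\<close>

lemma eventually_ess_at_left:
  "eventually P (ess_at_left t) \<longleftrightarrow> (\<exists>b<t. AE s in lebesgue. b < s \<longrightarrow> s < t \<longrightarrow> P s)"
proof
  assume "eventually P (ess_at_left t)"
  then obtain Q R where Q: "eventually Q (at_left t)" and R: "AE s in lebesgue. R s"
    and P: "\<And>s. Q s \<Longrightarrow> R s \<Longrightarrow> P s"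
    unfolding ess_at_left_def eventually_inf by blast
  obtain b where "b < t" "\<And>y. b < y \<Longrightarrow> y < t \<Longrightarrow> Q y"
    using Q unfolding eventually_at_left_field by blast
  then show "\<exists>b<t. AE s in lebesgue. b < s \<longrightarrow> s < t \<longrightarrow> P s"
    using R P by (intro exI[of _ b] conjI) (auto elim: eventually_mono)
next
  assume "\<exists>b<t. AE s in lebesgue. b < s \<longrightarrow> s < t \<longrightarrow> P s"
  then obtain b where b: "b < t" "AE s in lebesgue. b < s \<longrightarrow> s < t \<longrightarrow> P s" by blast
  then have "eventually (\<lambda>s. b < s \<and> s < t) (at_left t)"
    unfolding eventually_at_left_field by blast
  with b(2) show "eventually P (ess_at_left t)"
    unfolding ess_at_left_def eventually_inf by blast
qed

lemma eventually_ess_at_right: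
  "eventually P (ess_at_right t) \<longleftrightarrow> (\<exists>b>t. AE s in lebesgue. t < s \<longrightarrow> s < b \<longrightarrow> P s)"
proof
  assume "eventually P (ess_at_right t)"
  then obtain Q R where Q: "eventually Q (at_right t)" and R: "AE s in lebesgue. R s"
    and P: "\<And>s. Q s \<Longrightarrow> R s \<Longrightarrow> P s"
    unfolding ess_at_right_def eventually_inf by blast
  obtain b where "t < b" "\<And>y. t < y \<Longrightarrow> y < b \<Longrightarrow> Q y"
    using Q unfolding eventually_at_right_field by blast
  then show "\<exists>b>t. AE s in lebesgue. t < s \<longrightarrow> s < b \<longrightarrow> P s"
    using R P by (intro exI[of _ b] conjI) (auto elim: eventually_mono)
next
  assume "\<exists>b>t. AE s in lebesgue. t < s \<longrightarrow> s < b \<longrightarrow> P s"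
  then obtain b where b: "t < b" "AE s in lebesgue. t < s \<longrightarrow> s < b \<longrightarrow> P s" by blast
  then have "eventually (\<lambda>s. t < s \<and> s < b) (at_right t)"
    unfolding eventually_at_right_field by blast
  with b(2) show "eventually P (ess_at_right t)"
    unfolding ess_at_right_def eventually_inf by blast
qed

lemma ess_at_left_le: "ess_at_left t \<le> at_left t"
  and ess_at_right_le: "ess_at_right t \<le> at_right t"
  unfolding ess_at_left_def ess_at_right_def by simp_all

lemma ess_at_left_le_at: "ess_at_left t \<le> at t"
  and ess_at_right_le_at: "ess_at_right t \<le> at t"
  using ess_at_left_le ess_at_right_le at_le[of "{..<t}" UNIV t] at_le[of "{t<..}" UNIV t]
  by (meson order_trans subset_UNIV)+

lemma AE_eventually_ess_at:
  assumes "AE s in lebesgue. s \<in> U \<longrightarrow> P s" "open U" "t \<in> U"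
  shows "eventually P (ess_at_left t)" "eventually P (ess_at_right t)"
proof -
  obtain e where "e > 0" "ball t e \<subseteq> U"
    using assms(2,3) open_contains_ball by blast
  then have "\<And>s. t - e < s \<Longrightarrow> s < t \<Longrightarrow> s \<in> U" "\<And>s. t < s \<Longrightarrow> s < t + e \<Longrightarrow> s \<in> U"
    by (auto simp: dist_real_def subset_eq)
  then have "AE s in lebesgue. t - e < s \<longrightarrow> s < t \<longrightarrow> P s" "AE s in lebesgue. t < s \<longrightarrow> s < t + e \<longrightarrow> P s"
    using assms(1) by (auto elim!: eventually_mono)
  moreover have "t - e < t" "t < t + e" using \<open>e > 0\<close> by auto
  ultimately show "eventually P (ess_at_left t)" "eventually P (ess_at_right t)"
    unfolding eventually_ess_at_left eventually_ess_at_right by blast+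
qed

lemma left_val_eqI: "(g \<longlongrightarrow> l) (ess_at_left t) \<Longrightarrow> left_val g t = l"
  unfolding left_val_def by (rule tendsto_Lim[OF ess_at_left_not_bot])

lemma right_val_eqI: "(g \<longlongrightarrow> l) (ess_at_right t) \<Longrightarrow> right_val g t = l"
  unfolding right_val_def by (rule tendsto_Lim[OF ess_at_right_not_bot])

lemma left_val_cong: "eventually (\<lambda>s. g s = h s) (ess_at_left t) \<Longrightarrow> left_val g t = left_val h t"
  unfolding left_val_def by (rule Lim_cong) auto

lemma right_val_cong: "eventually (\<lambda>s. g s = h s) (ess_at_right t) \<Longrightarrow> right_val g t = right_val h t"
  unfolding right_val_def by (rule Lim_cong) auto

text \<open>For each bound \<open>e\<close>, every point of \<open>U\<close> lies in an open
  interval on which \<open>cmod (g s) < e\<close> almost everywhere. By Lindelof countably many such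
  sets cover \<open>U\<close>, so the bound holds almost everywhere on \<open>U\<close>. Letting
  \<open>e\<close> run through the reciprocals of the positive integers gives the claim.\<close>

lemma ess_limits_0_imp_AE_0:
  fixes g :: "real \<Rightarrow> complex"
  assumes "open U"
    and lim: "\<And>t. t \<in> U \<Longrightarrow> (g \<longlongrightarrow> 0) (ess_at_left t)" "\<And>t. t \<in> U \<Longrightarrow> (g \<longlongrightarrow> 0) (ess_at_right t)"
  shows "AE t in lebesgue. t \<in> U \<longrightarrow> g t = 0"
proof -
  have small: "AE t in lebesgue. t \<in> U \<longrightarrow> cmod (g t) < e" if "e > 0" for e
  proof -
    let ?\<F> = "{V. open V \<and> (AE t in lebesgue. t \<in> V \<longrightarrow> cmod (g t) < e)}"
    obtain \<G> where \<G>: "\<G> \<subseteq> ?\<F>" "countable \<G>" "\<Union>\<G> = \<Union>?\<F>"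
      using Lindelof[of ?\<F>] by auto
    have "U \<subseteq> \<Union>?\<F>"
    proof
      fix t assume "t \<in> U"
      obtain a where a: "a < t" "AE s in lebesgue. a < s \<longrightarrow> s < t \<longrightarrow> cmod (g s) < e"
        using tendstoD[OF lim(1)[OF \<open>t \<in> U\<close>] \<open>e > 0\<close>] unfolding eventually_ess_at_left by auto
      obtain b where b: "t < b" "AE s in lebesgue. t < s \<longrightarrow> s < b \<longrightarrow> cmod (g s) < e"
        using tendstoD[OF lim(2)[OF \<open>t \<in> U\<close>] \<open>e > 0\<close>] unfolding eventually_ess_at_right by auto
      \<comment> \<open>The one-sided estimates say nothing at \<open>t\<close>; a single point is
        null, so they join to an estimate on the open interval around \<open>t\<close>.\<close>
      have "AE s in lebesgue. s \<noteq> t"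
        using AE_not_in[of "{t}" lebesgue] by (simp add: null_sets_completionI)
      with a(2) b(2) have "AE s in lebesgue. s \<in> {a<..<b} \<longrightarrow> cmod (g s) < e"
        by eventually_elim force
      with a(1) b(1) show "t \<in> \<Union>?\<F>" by (intro UnionI[of "{a<..<b}"]) auto
    qed
    moreover have "AE t in lebesgue. \<forall>V\<in>\<G>. t \<in> V \<longrightarrow> cmod (g t) < e"
      using \<G> by (intro AE_ball_countable') auto
    ultimately show ?thesis using \<G>(3) by (auto elim!: eventually_mono)
  qed
  have "AE t in lebesgue. \<forall>n. t \<in> U \<longrightarrow> cmod (g t) < inverse (real (Suc n))"
    unfolding AE_all_countable by (intro allI small) simp
  then show ?thesis
  proof eventually_elim
    case (elim t)
    show ?case
    proof (intro impI, rule ccontr)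
      assume "t \<in> U" "g t \<noteq> 0"
      then obtain n where "inverse (real (Suc n)) < cmod (g t)"
        using reals_Archimedean[of "cmod (g t)"] by auto
      with elim \<open>t \<in> U\<close> show False by (meson less_asym)
    qed
  qed
qed

text \<open>This is how information on one-sided values at every point becomes information on the
  function almost everywhere.\<close>

lemma GG_AE_0:
  assumes "g \<in> GG I" "open U" "U \<subseteq> I"
    and "\<And>t. t \<in> U \<Longrightarrow> left_val g t = 0" "\<And>t. t \<in> U \<Longrightarrow> right_val g t = 0"
  shows "AE t in lebesgue. t \<in> U \<longrightarrow> g t = 0"
proof (rule ess_limits_0_imp_AE_0)
  fix t assume "t \<in> U"
  then show "(g \<longlongrightarrow> 0) (ess_at_left t)" "(g \<longlongrightarrow> 0) (ess_at_right t)"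
    using assms GG_tendsto_left[of g I t] GG_tendsto_right[of g I t] by auto
qed fact

lemma ae_eq_on_vals:
  assumes "open I" "ae_eq_on I g h" "t \<in> I"
  shows "eventually (\<lambda>s. g s = h s) (ess_at_left t)" "eventually (\<lambda>s. g s = h s) (ess_at_right t)"
    "left_val g t = left_val h t" "right_val g t = right_val h t"
proof -
  have "AE s in lebesgue. s \<in> I \<longrightarrow> g s = h s"
    using assms(2) unfolding ae_eq_on_def AE_lebesgue_on_iff[OF assms(1)] .
  from AE_eventually_ess_at[OF this assms(1,3)]
  show "eventually (\<lambda>s. g s = h s) (ess_at_left t)" "eventually (\<lambda>s. g s = h s) (ess_at_right t)"
    "left_val g t = left_val h t" "right_val g t = right_val h t"
    by (auto intro: left_val_cong right_val_cong)
qed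

lemma ae_eq_on_sym: "ae_eq_on I g h \<Longrightarrow> ae_eq_on I h g"
  unfolding ae_eq_on_def by (auto elim: eventually_mono)


section \<open>Uniqueness of derivatives\<close>

text \<open>The difference quotients of \<open>g\<close> determine both one-sided values of a
  derivative at every point, so the difference of two derivatives has only zero one-sided
  values.\<close>

lemma is_gderiv_unique:
  assumes "open I" "is_gderiv I g h" "is_gderiv I g h'"
  shows "ae_eq_on I h h'"
proof -
  have G: "h \<in> GG I" "h' \<in> GG I" using assms by (auto simp: is_gderiv_def)
  have "AE t in lebesgue. t \<in> I \<longrightarrow> 1 * h t + (-1) * h' t = 0"
  proof (rule GG_AE_0[OF GG_lincomb[OF G] \<open>open I\<close> order_refl])
    fix t assume "t \<in> I"
    then have "left_val h t = left_val h' t" "right_val h t = right_val h' t"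
      using assms(2,3) tendsto_unique[OF ess_at_left_not_bot] tendsto_unique[OF ess_at_right_not_bot]
      unfolding is_gderiv_def by blast+
    then show "left_val (\<lambda>s. 1 * h s + (-1) * h' s) t = 0" "right_val (\<lambda>s. 1 * h s + (-1) * h' s) t = 0"
      unfolding left_val_lincomb[OF G \<open>t \<in> I\<close>] right_val_lincomb[OF G \<open>t \<in> I\<close>] by simp_all
  qed
  then show ?thesis
    unfolding ae_eq_on_def AE_lebesgue_on_iff[OF \<open>open I\<close>] by (auto elim: eventually_mono)
qed

text \<open>Difference quotients and one-sided values see the function only through the essential
  filters, along which the two representatives eventually agree.\<close>

lemma is_gderiv_cong:
  assumes "open I" "ae_eq_on I g g'" "is_gderiv I g h"
  shows "is_gderiv I g' h"
  unfolding is_gderiv_def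
proof (intro conjI ballI)
  show "h \<in> GG I" using assms(3) by (simp add: is_gderiv_def)
  fix t assume t: "t \<in> I"
  note ev = ae_eq_on_vals[OF assms(1,2) t]
  have "((\<lambda>s. (g s - left_val g t) / complex_of_real (s - t)) \<longlongrightarrow> left_val h t) (ess_at_left t)"
    "((\<lambda>s. (g s - right_val g t) / complex_of_real (s - t)) \<longlongrightarrow> right_val h t) (ess_at_right t)"
    using assms(3) t by (auto simp: is_gderiv_def)
  then show "((\<lambda>s. (g' s - left_val g' t) / complex_of_real (s - t)) \<longlongrightarrow> left_val h t) (ess_at_left t)"
    "((\<lambda>s. (g' s - right_val g' t) / complex_of_real (s - t)) \<longlongrightarrow> right_val h t) (ess_at_right t)"
    unfolding ev(3,4)
    using eventually_mono[OF ev(1)] eventually_mono[OF ev(2)]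
    by (smt (verit, ccfv_threshold) Lim_transform_eventually)+
qed

lemma is_gderiv_gderiv: "is_gderiv I g h \<Longrightarrow> is_gderiv I g (gderiv I g)"
  unfolding gderiv_def by (rule someI[of "is_gderiv I g"])

lemma gderiv_ae_eq: "open I \<Longrightarrow> is_gderiv I g h \<Longrightarrow> ae_eq_on I (gderiv I g) h"
  by (metis is_gderiv_gderiv is_gderiv_unique)

text \<open>Each application of \<open>gderiv\<close> makes a fresh choice of representative, so
  agreement with a given chain of derivatives holds only almost everywhere.
  \<open>is_gderiv_cong\<close> carries the chain past each choice.\<close>

lemma gderivs_ae_eq:
  assumes "open I" "\<And>k. is_gderiv I (d k) (d (Suc k))"
  shows "ae_eq_on I (gderivs I k (d 0)) (d k)"
proof (induction k)
  case 0
  show ?case by (simp add: ae_eq_on_def)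
next
  case (Suc k)
  have "is_gderiv I (gderivs I k (d 0)) (d (Suc k))"
    by (rule is_gderiv_cong[OF assms(1) ae_eq_on_sym[OF Suc] assms(2)])
  then show ?case using gderiv_ae_eq[OF assms(1)] by simp
qed

lemma gderivs_ae_eq_cong:
  assumes "open I" "ae_eq_on I g (d 0)" "\<And>k. is_gderiv I (d k) (d (Suc k))"
  shows "ae_eq_on I (gderivs I k g) (d k)"
proof -
  \<comment> \<open>Replacing the first member of a chain by an equivalent representative leaves a
    chain.\<close>
  have "is_gderiv I ((d(0 := g)) k) ((d(0 := g)) (Suc k))" for k
    using assms(3) is_gderiv_cong[OF assms(1) ae_eq_on_sym[OF assms(2)]] by auto
  from gderivs_ae_eq[of I "d(0 := g)" k, OF assms(1) this]
  show ?thesis using assms(2) by (cases k) (auto simp: fun_upd_def)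
qed

text \<open>Membership in \<open>GG_inf I\<close> only asserts that some chain exists; comparison
  with it shows that the choices made by \<open>gderiv\<close> succeed at every order.\<close>

lemma GG_inf_gderivs:
  assumes "open I" "g \<in> GG_inf I"
  shows "is_gderiv I (gderivs I k g) (gderivs I (Suc k) g)" "gderivs I k g \<in> GG I"
proof -
  obtain d where d: "d 0 = g" "\<And>k. is_gderiv I (d k) (d (Suc k))"
    using assms(2) by (auto simp: GG_inf_def)
  have "is_gderiv I (gderivs I k g) (d (Suc k))" for k
    using is_gderiv_cong[OF assms(1) ae_eq_on_sym[OF gderivs_ae_eq[of I d, OF assms(1) d(2)]] d(2)] d(1)
    by auto
  then show *: "is_gderiv I (gderivs I k g) (gderivs I (Suc k) g)" for k
    by (auto intro: is_gderiv_gderiv)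
  show "gderivs I k g \<in> GG I"
    using assms(2) *[of "k - 1"] by (cases k) (auto simp: GG_inf_def is_gderiv_def)
qed

lemma GG_inf_is_gderiv: "open I \<Longrightarrow> g \<in> GG_inf I \<Longrightarrow> is_gderiv I g (gderiv I g)"
  using GG_inf_gderivs(1)[of I g 0] by simp

lemma gderivs_gderiv: "gderivs I k (gderiv I g) = gderivs I (Suc k) g"
  by (simp add: funpow_swap1)

lemma gderiv_GG_inf:
  assumes "open I" "g \<in> GG_inf I"
  shows "gderiv I g \<in> GG_inf I"
  unfolding GG_inf_def
  using GG_inf_gderivs(1)[OF assms, of "Suc _"] GG_inf_gderivs(2)[OF assms, of "Suc 0"]
  by (intro CollectI conjI exI[of _ "\<lambda>k. gderivs I (Suc k) g"]) auto

text \<open>Putting \<open>g\<close> in front of a chain for \<open>h\<close> gives a chain for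
  \<open>g\<close>. Step functions and primitives enter \<open>GG_inf I\<close> this way.\<close>

lemma GG_inf_antiderivative:
  assumes "g \<in> GG I" "is_gderiv I g h" "h \<in> GG_inf I"
  shows "g \<in> GG_inf I"
proof -
  obtain d where d: "d 0 = h" "\<And>k. is_gderiv I (d k) (d (Suc k))"
    using assms(3) by (auto simp: GG_inf_def)
  have "is_gderiv I (case_nat g d k) (case_nat g d (Suc k))" for k
    using assms(2) d by (cases k) auto
  then show ?thesis
    unfolding GG_inf_def using assms(1) by (intro CollectI conjI exI[of _ "case_nat g d"]) auto
qed

lemma gderivs_lincomb:
  assumes "open I" "g \<in> GG_inf I" "h \<in> GG_inf I"
  shows "ae_eq_on I (gderivs I k (\<lambda>s. \<alpha> * g s + \<beta> * h s)) (\<lambda>s. \<alpha> * gderivs I k g s + \<beta> * gderivs I k h s)"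
  using gderivs_ae_eq[of I "\<lambda>k s. \<alpha> * gderivs I k g s + \<beta> * gderivs I k h s" k, OF assms(1)]
    is_gderiv_lincomb GG_inf_gderivs[OF assms(1,2)] GG_inf_gderivs[OF assms(1,3)] by auto


section \<open>The norms\<close>

lemma Linf_norm_AE: "g \<in> GG I \<Longrightarrow> AE t in lebesgue_on I. cmod (g t) \<le> Linf_norm I g"
  using esssup_AE[of "\<lambda>t. ereal (cmod (g t))" "lebesgue_on I"]
proof (rule eventually_mono)
  fix t assume "g \<in> GG I" and *: "ereal (cmod (g t)) \<le> esssup (lebesgue_on I) (\<lambda>t. ereal (cmod (g t)))"
  \<comment> \<open>Membership in \<open>GG I\<close> excludes the value infinity and
    \<open>*\<close> excludes minus infinity, so \<open>real_of_ereal\<close> keeps the essential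
    supremum.\<close>
  then show "cmod (g t) \<le> Linf_norm I g"
    unfolding Linf_norm_def GG_def
    by (cases "esssup (lebesgue_on I) (\<lambda>t. ereal (cmod (g t)))") auto
qed

lemma Linf_norm_le:
  assumes "g \<in> GG I" "0 \<le> C" "AE t in lebesgue_on I. cmod (g t) \<le> C"
  shows "Linf_norm I g \<le> C"
proof -
  have "g \<in> borel_measurable (lebesgue_on I)" using assms(1) by (simp add: GG_def)
  then have "esssup (lebesgue_on I) (\<lambda>t. ereal (cmod (g t))) \<le> ereal C"
    using assms(3) by (intro esssup_I) auto
  then show ?thesis
    unfolding Linf_norm_def
    using assms(2) by (cases "esssup (lebesgue_on I) (\<lambda>t. ereal (cmod (g t)))") auto
qed

text \<open>Infinite essential suprema are sent to 0 by \<open>real_of_ereal\<close>, so only a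
  negative real value must be excluded. It would bound a norm by a negative number at almost every
  point, which is absurd there, and then minus infinity would be an essential bound as well.\<close>

lemma Linf_norm_nonneg: "0 \<le> Linf_norm I g"
proof (rule ccontr)
  assume *: "\<not> 0 \<le> Linf_norm I g"
  let ?E = "esssup (lebesgue_on I) (\<lambda>t. ereal (cmod (g t)))"
  obtain r where r: "?E = ereal r" "r < 0"
    using * unfolding Linf_norm_def by (cases ?E) auto
  then have "(\<lambda>t. ereal (cmod (g t))) \<in> borel_measurable (lebesgue_on I)"
    using esssup_non_measurable[of "\<lambda>t. ereal (cmod (g t))" "lebesgue_on I"] by (auto simp: top_ereal_def)
  moreover have "AE t in lebesgue_on I. ereal (cmod (g t)) \<le> -\<infinity>"
    using esssup_AE[of "\<lambda>t. ereal (cmod (g t))" "lebesgue_on I"]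
  proof (rule eventually_mono)
    fix t assume "ereal (cmod (g t)) \<le> ?E"
    then show "ereal (cmod (g t)) \<le> -\<infinity>" using r norm_ge_zero[of "g t"] by auto
  qed
  ultimately have "?E \<le> -\<infinity>" by (rule esssup_I)
  with r show False by simp
qed

lemma Linf_norm_le_knorm: "i \<le> k \<Longrightarrow> Linf_norm I (gderivs I i g) \<le> knorm I k g"
  unfolding knorm_def by (intro Max_ge) auto

lemma knorm_le: "(\<And>i. i \<le> k \<Longrightarrow> Linf_norm I (gderivs I i g) \<le> C) \<Longrightarrow> knorm I k g \<le> C"
  unfolding knorm_def by (intro Max.boundedI) auto

lemma knorm_nonneg: "0 \<le> knorm I k g"
  using Linf_norm_nonneg Linf_norm_le_knorm[of 0 k I g] by (meson order_trans zero_le)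

lemma knorm_scale_le:
  assumes "open I" "g \<in> GG_inf I"
  shows "knorm I k (\<lambda>s. c * g s) \<le> cmod c * knorm I k g"
proof (rule knorm_le)
  fix i assume "i \<le> k"
  have *: "ae_eq_on I (gderivs I i (\<lambda>s. c * g s)) (\<lambda>s. c * gderivs I i g s)"
    using gderivs_lincomb[OF assms(1,2,2), of i c 0] by simp
  have "AE s in lebesgue_on I. cmod (gderivs I i (\<lambda>s. c * g s) s) \<le> cmod c * knorm I k g"
    using * [unfolded ae_eq_on_def] Linf_norm_AE[OF GG_inf_gderivs(2)[OF assms, of i]]
  proof eventually_elim
    case (elim s)
    then show ?case
      using Linf_norm_le_knorm[OF \<open>i \<le> k\<close>, of I g] by (auto simp: norm_mult intro!: mult_left_mono)
  qed
  moreover have "(\<lambda>s. c * g s) \<in> GG_inf I"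
    using GG_inf_lincomb[OF assms(2,2), of c 0] by simp
  ultimately show "Linf_norm I (gderivs I i (\<lambda>s. c * g s)) \<le> cmod c * knorm I k g"
    by (intro Linf_norm_le GG_inf_gderivs assms mult_nonneg_nonneg knorm_nonneg) auto
qed


section \<open>Supports of test functions\<close>

lemma vals_const: "left_val (\<lambda>_. c) t = c" "right_val (\<lambda>_. c) t = c"
  by (auto intro: left_val_eqI right_val_eqI)

lemma zero_GG: "(\<lambda>_. 0) \<in> GG I"
  unfolding GG_def using esssup_less_infinity_iff[of "\<lambda>_. 0" I] by (auto intro!: exI[of _ 0])

lemma is_gderiv_zero: "is_gderiv I (\<lambda>_. 0) (\<lambda>_. 0)"
  by (auto simp: is_gderiv_def vals_const zero_GG)

lemma zero_GG_inf: "(\<lambda>_. 0) \<in> GG_inf I"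
  unfolding GG_inf_def using zero_GG is_gderiv_zero by auto

lemma zero_RR: "(\<lambda>_. 0) \<in> RR I"
  unfolding RR_def gsupp_def by (auto simp: vals_const zero_GG_inf)

lemma inner_interval_Icc:
  assumes "is_interval I" "c \<in> I" "d \<in> I"
  shows "inner_interval I {c..d}"
  using assms mem_is_interval_1_I[of I c d] by (auto simp: inner_interval_def is_interval_cc)

text \<open>Inserting \<open>t\<close> makes the set nonempty and puts \<open>t\<close> into the
  hull. The endpoints are members of the set itself, so that properties of the support pass to
  them.\<close>

lemma compact_hull_Icc:
  fixes K :: "real set"
  assumes "compact K"
  obtains c d where "c \<in> insert t K" "d \<in> insert t K" "insert t K \<subseteq> {c..d}"
proof -
  have "compact (insert t K)" using assms by simp
  then show thesis
    using compact_attains_inf[of "insert t K"] compact_attains_sup[of "insert t K"] that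
    by (metis atLeastAtMost_iff insert_not_empty subsetI)
qed

text \<open>Off \<open>C\<close> all one-sided values vanish, so \<open>GG_AE_0\<close> applies.
  With the converse \<open>gsupp_subset_RR_on\<close>, conditions on the support and membership in
  \<open>RR_on\<close> can be exchanged for closed sets.\<close>

lemma RR_on_gsupp_subset:
  assumes "open I" "closed C" "\<phi> \<in> GG_inf I" "gsupp I \<phi> \<subseteq> C"
  shows "\<phi> \<in> RR_on I C"
proof -
  let ?A = "{t \<in> I. left_val \<phi> t \<noteq> 0 \<or> right_val \<phi> t \<noteq> 0}"
  have "?A \<subseteq> C" using assms(4) closure_subset[of ?A] by (auto simp: gsupp_def)
  then have "AE t in lebesgue. t \<in> I - C \<longrightarrow> \<phi> t = 0"
    using assms by (intro GG_AE_0[of _ I]) (auto simp: GG_inf_def)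
  then show ?thesis
    using assms(3) unfolding RR_on_def AE_lebesgue_on_iff[OF assms(1)] by (auto elim: eventually_mono)
qed

lemma RR_on_vals_0:
  assumes "open I" "closed C" "\<phi> \<in> RR_on I C" "t \<in> I - C"
  shows "left_val \<phi> t = 0" "right_val \<phi> t = 0"
proof -
  have "AE s in lebesgue. s \<in> I - C \<longrightarrow> \<phi> s = 0"
    using assms(3) unfolding RR_on_def AE_lebesgue_on_iff[OF assms(1)] by (auto elim: eventually_mono)
  note AE_eventually_ess_at[OF this open_Diff[OF assms(1,2)] assms(4)]
  then show "left_val \<phi> t = 0" "right_val \<phi> t = 0"
    using left_val_cong[of \<phi> "\<lambda>_. 0"] right_val_cong[of \<phi> "\<lambda>_. 0"] by (auto simp: vals_const)
qed

lemma gsupp_subset_RR_on: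
  assumes "open I" "closed C" "\<phi> \<in> RR_on I C"
  shows "gsupp I \<phi> \<subseteq> C"
proof -
  have "{t \<in> I. left_val \<phi> t \<noteq> 0 \<or> right_val \<phi> t \<noteq> 0} \<subseteq> C"
    using RR_on_vals_0[OF assms] by auto
  then show ?thesis unfolding gsupp_def using closure_minimal[OF _ assms(2)] by blast
qed

lemma RR_on_mono: "J \<subseteq> K \<Longrightarrow> RR_on I J \<subseteq> RR_on I K"
  unfolding RR_on_def by (auto elim: eventually_mono)

lemma inner_interval_hull:
  assumes "is_interval I" "inner_interval I J" "t \<in> I"
  obtains c d where "c \<le> t" "t \<le> d" "J \<subseteq> {c..d}" "{c..d} \<subseteq> I" "inner_interval I {c..d}"
proof -
  have "compact (closure J)" using assms(2) by (auto simp: inner_interval_def)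
  then obtain c d where cd: "c \<in> insert t (closure J)" "d \<in> insert t (closure J)"
    "insert t (closure J) \<subseteq> {c..d}"
    by (rule compact_hull_Icc)
  then have "inner_interval I {c..d}"
    using assms by (intro inner_interval_Icc) (auto simp: inner_interval_def)
  moreover have "J \<subseteq> {c..d}" "c \<le> t" "t \<le> d" using cd(3) closure_subset[of J] by auto
  ultimately show thesis using that by (simp add: inner_interval_def)
qed

text \<open>Puts every test function into one of the normed spaces over a compact interval through a
  prescribed point. That each endpoint is \<open>t\<close> or a support point is what later keeps
  supports to the left of a bound.\<close>

lemma RR_on_Icc:
  assumes "open I" "is_interval I" "t \<in> I" "\<phi> \<in> RR I"
  obtains c d where "c \<in> insert t (gsupp I \<phi>)" "d \<in> insert t (gsupp I \<phi>)" "c \<le> t" "t \<le> d"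
    "{c..d} \<subseteq> I" "inner_interval I {c..d}" "\<phi> \<in> RR_on I {c..d}"
proof -
  have "compact (gsupp I \<phi>)" using assms(4) by (simp add: RR_def)
  then obtain c d where cd: "c \<in> insert t (gsupp I \<phi>)" "d \<in> insert t (gsupp I \<phi>)"
    "insert t (gsupp I \<phi>) \<subseteq> {c..d}"
    by (rule compact_hull_Icc)
  moreover have "inner_interval I {c..d}"
    using cd assms by (intro inner_interval_Icc) (auto simp: gsupp_def)
  moreover have "\<phi> \<in> RR_on I {c..d}"
    using cd assms by (intro RR_on_gsupp_subset) (auto simp: RR_def)
  moreover have "c \<le> t" "t \<le> d" using cd(3) by auto
  ultimately show thesis using that[of c d] cd(1,2) by (simp add: inner_interval_def)
qed


section \<open>Continuous functionals\<close>

lemma RR_dual_lin: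
  "f \<in> RR_dual I \<Longrightarrow> \<phi> \<in> RR I \<Longrightarrow> \<psi> \<in> RR I \<Longrightarrow>
    f (\<lambda>t. \<alpha> * \<phi> t + \<beta> * \<psi> t) = \<alpha> * f \<phi> + \<beta> * f \<psi>"
  and RR_dual_ae: "f \<in> RR_dual I \<Longrightarrow> \<phi> \<in> RR I \<Longrightarrow> \<psi> \<in> RR I \<Longrightarrow> ae_eq_on I \<phi> \<psi> \<Longrightarrow> f \<phi> = f \<psi>"
  by (auto simp: RR_dual_def)

lemma RR_dual_zero: "f \<in> RR_dual I \<Longrightarrow> f (\<lambda>_. 0) = 0"
  using RR_dual_lin[of f I "\<lambda>_. 0" "\<lambda>_. 0" 0 0] zero_RR by simp

lemma RR_sum:
  assumes "finite S" "\<And>s. s \<in> S \<Longrightarrow> h s \<in> RR I"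
  shows "(\<lambda>t. \<Sum>s\<in>S. c s * h s t) \<in> RR I"
  using assms
proof (induction S rule: finite_induct)
  case empty
  then show ?case using zero_RR by simp
next
  case (insert a S)
  then show ?case using RR_lincomb[of "h a" I "\<lambda>t. \<Sum>s\<in>S. c s * h s t" "c a" 1] by simp
qed

lemma RR_dual_sum:
  assumes "f \<in> RR_dual I" "finite S" "\<And>s. s \<in> S \<Longrightarrow> h s \<in> RR I"
  shows "f (\<lambda>t. \<Sum>s\<in>S. c s * h s t) = (\<Sum>s\<in>S. c s * f (h s))"
  using assms(2,3)
proof (induction S rule: finite_induct)
  case empty
  then show ?case using RR_dual_zero[OF assms(1)] by simp
next
  case (insert a S)
  then have "h a \<in> RR I" "(\<lambda>t. \<Sum>s\<in>S. c s * h s t) \<in> RR I" by (auto intro: RR_sum)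
  from RR_dual_lin[OF assms(1) this, of "c a" 1] show ?case using insert by simp
qed

text \<open>The preimage of the open unit disc is an open set containing 0, and hence contains a
  ball of each normed space.\<close>

lemma RR_dual_bounded:
  assumes "open I" "f \<in> RR_dual I" "inner_interval I J"
  obtains k \<epsilon> where "\<epsilon> > 0" "\<And>\<phi>. \<phi> \<in> RR_on I J \<Longrightarrow> knorm I k \<phi> < \<epsilon> \<Longrightarrow> cmod (f \<phi>) < 1"
proof -
  have "openin (RR_top I) {\<phi> \<in> topspace (RR_top I). f \<phi> \<in> ball 0 1}"
    using assms(2) by (intro openin_continuous_map_preimage) (auto simp: RR_dual_def)
  then have "RR_open I {\<phi> \<in> RR I. f \<phi> \<in> ball 0 1}"
    by (simp add: openin_RR_top topspace_RR_top[OF assms(1)])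
  moreover have "(\<lambda>_. 0) \<in> {\<phi> \<in> RR I. f \<phi> \<in> ball 0 1}"
    using zero_RR RR_dual_zero[OF assms(2)] by auto
  ultimately obtain V where V: "RR_nhd0 I V" "\<forall>\<psi>\<in>V. (\<lambda>t. 0 + \<psi> t) \<in> {\<phi> \<in> RR I. f \<phi> \<in> ball 0 1}"
    unfolding RR_open_def by blast
  obtain k \<epsilon> where "\<epsilon> > 0" "{\<phi> \<in> RR_on I J. knorm I k \<phi> < \<epsilon>} \<subseteq> V"
    using V(1) assms(3) unfolding RR_nhd0_def by blast
  then show thesis using V(2) by (intro that[of \<epsilon> k]) auto
qed

text \<open>For the inductive limit topology, a linear functional need only be bounded on a ball of
  each normed space. By homogeneity the sets where \<open>cmod (f \<psi>) < r\<close> are then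
  neighbourhoods of 0, and by additivity their translates give continuity everywhere.\<close>

lemma RR_dualI:
  assumes "open I"
    and lin: "\<And>\<phi> \<psi> \<alpha> \<beta>. \<phi> \<in> RR I \<Longrightarrow> \<psi> \<in> RR I \<Longrightarrow>
      f (\<lambda>t. \<alpha> * \<phi> t + \<beta> * \<psi> t) = \<alpha> * f \<phi> + \<beta> * f \<psi>"
    and ae: "\<And>\<phi> \<psi>. \<phi> \<in> RR I \<Longrightarrow> \<psi> \<in> RR I \<Longrightarrow> ae_eq_on I \<phi> \<psi> \<Longrightarrow> f \<phi> = f \<psi>"
    and bdd: "\<And>J. inner_interval I J \<Longrightarrow>
      \<exists>k. \<exists>\<epsilon>>0. \<forall>\<phi>\<in>RR_on I J. knorm I k \<phi> < \<epsilon> \<longrightarrow> cmod (f \<phi>) < 1"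
  shows "f \<in> RR_dual I"
proof -
  have nhd: "RR_nhd0 I {\<psi> \<in> RR I. cmod (f \<psi>) < r}" if "r > 0" for r
    unfolding RR_nhd0_def
  proof (intro conjI allI impI)
    show "abs_convex {\<psi> \<in> RR I. cmod (f \<psi>) < r}"
      unfolding abs_convex_def
    proof (intro conjI ballI allI impI)
      have "f (\<lambda>_. 0) = 0" using lin[OF zero_RR zero_RR, of 0 0] by simp
      then have "(\<lambda>_. 0) \<in> {\<psi> \<in> RR I. cmod (f \<psi>) < r}" using zero_RR \<open>r > 0\<close> by simp
      then show "{\<psi> \<in> RR I. cmod (f \<psi>) < r} \<noteq> {}" by (metis empty_iff)
      fix x y :: "real \<Rightarrow> complex" and \<alpha> \<beta> :: complex
      assume x: "x \<in> {\<psi> \<in> RR I. cmod (f \<psi>) < r}" and y: "y \<in> {\<psi> \<in> RR I. cmod (f \<psi>) < r}"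
        and ab: "cmod \<alpha> + cmod \<beta> \<le> 1"
      let ?m = "max (cmod (f x)) (cmod (f y))"
      have "cmod (\<alpha> * f x + \<beta> * f y) \<le> cmod \<alpha> * cmod (f x) + cmod \<beta> * cmod (f y)"
        by (metis norm_mult norm_triangle_ineq)
      also have "\<dots> \<le> cmod \<alpha> * ?m + cmod \<beta> * ?m"
        by (intro add_mono mult_left_mono) auto
      also have "\<dots> = (cmod \<alpha> + cmod \<beta>) * ?m" by (simp add: distrib_right)
      also have "\<dots> \<le> 1 * ?m" using ab by (intro mult_right_mono) (auto simp: le_max_iff_disj)
      also have "\<dots> < r" using x y by auto
      finally show "(\<lambda>t. \<alpha> * x t + \<beta> * y t) \<in> {\<psi> \<in> RR I. cmod (f \<psi>) < r}"
        using x y by (auto simp: lin RR_lincomb)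
    qed
    fix J assume J: "inner_interval I J"
    then obtain k \<epsilon> where k: "\<epsilon> > 0" "\<forall>\<phi>\<in>RR_on I J. knorm I k \<phi> < \<epsilon> \<longrightarrow> cmod (f \<phi>) < 1"
      using bdd by blast
    have "cmod (f \<phi>) < r" if \<phi>: "\<phi> \<in> RR_on I J" "knorm I k \<phi> < \<epsilon> * r" for \<phi>
    proof -
      \<comment> \<open>Rescaling by \<open>1 / r\<close> reduces the threshold \<open>r\<close> to
        the threshold 1 of the assumption, with radius \<open>\<epsilon> * r\<close> in place of
        \<open>\<epsilon>\<close>.\<close>
      let ?\<psi> = "\<lambda>t. complex_of_real (1 / r) * \<phi> t"
      have G: "\<phi> \<in> GG_inf I" "\<phi> \<in> RR I" using \<phi> RR_on_subset_RR[OF assms(1) J] by (auto simp: RR_on_def)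
      have "knorm I k ?\<psi> \<le> cmod (complex_of_real (1 / r)) * knorm I k \<phi>"
        by (rule knorm_scale_le[OF assms(1) G(1)])
      also have "\<dots> < \<epsilon>" using \<phi>(2) \<open>r > 0\<close> by (simp add: norm_divide divide_simps)
      moreover have "?\<psi> \<in> RR_on I J"
        using \<phi>(1) GG_inf_lincomb[OF G(1) G(1), of "complex_of_real (1 / r)" 0]
        by (auto simp: RR_on_def elim: eventually_mono)
      ultimately have "cmod (f ?\<psi>) < 1" using k(2) by auto
      moreover have "f ?\<psi> = complex_of_real (1 / r) * f \<phi>"
        using lin[OF G(2) G(2), of "complex_of_real (1 / r)" 0] by simp
      ultimately have "cmod (complex_of_real (1 / r) * f \<phi>) < 1" by simp
      then show ?thesis using \<open>r > 0\<close> by (simp add: norm_mult norm_divide divide_simps)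
    qed
    then show "\<exists>k. \<exists>\<epsilon>>0. {\<phi> \<in> RR_on I J. knorm I k \<phi> < \<epsilon>} \<subseteq> {\<psi> \<in> RR I. cmod (f \<psi>) < r}"
      using k(1) \<open>r > 0\<close> RR_on_subset_RR[OF assms(1) J] by (intro exI[of _ k] exI[of _ "\<epsilon> * r"]) auto
  qed auto
  have "openin (RR_top I) {\<phi> \<in> RR I. f \<phi> \<in> U}" if "open U" for U
    unfolding openin_RR_top RR_open_def
  proof (intro conjI ballI)
    fix \<phi> assume \<phi>: "\<phi> \<in> {\<phi> \<in> RR I. f \<phi> \<in> U}"
    then have "f \<phi> \<in> U" by simp
    with that obtain r where r: "r > 0" "ball (f \<phi>) r \<subseteq> U" by (rule openE)
    have "(\<lambda>t. \<phi> t + \<psi> t) \<in> {\<phi> \<in> RR I. f \<phi> \<in> U}" if \<psi>: "\<psi> \<in> RR I" "cmod (f \<psi>) < r" for \<psi>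
    proof -
      have "f (\<lambda>t. \<phi> t + \<psi> t) = f \<phi> + f \<psi>" "(\<lambda>t. \<phi> t + \<psi> t) \<in> RR I"
        using lin[of \<phi> \<psi> 1 1] RR_lincomb[of \<phi> I \<psi> 1 1] \<phi> \<psi> by auto
      moreover have "f \<phi> + f \<psi> \<in> ball (f \<phi>) r" using \<psi>(2) by (simp add: dist_norm)
      ultimately show ?thesis using r(2) by auto
    qed
    then show "\<exists>V. RR_nhd0 I V \<and> (\<forall>\<psi>\<in>V. (\<lambda>t. \<phi> t + \<psi> t) \<in> {\<phi> \<in> RR I. f \<phi> \<in> U})"
      using nhd[OF r(1)] by blast
  qed auto
  then have "continuous_map (RR_top I) euclidean f"
    by (simp add: continuous_map_def topspace_RR_top[OF assms(1)])
  then show ?thesis using lin ae by (auto simp: RR_dual_def)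
qed

text \<open>The transpose of a continuous operator on test functions maps functionals to
  functionals. Linearity of \<open>T\<close> is required only almost everywhere, since
  \<open>gderiv\<close> picks representatives. One interval \<open>J'\<close> must serve all orders
  \<open>k\<close>, because the order needed for \<open>f\<close> is known only after
  \<open>J'\<close>.\<close>

lemma RR_dual_comp:
  assumes "open I" "f \<in> RR_dual I"
    and T: "\<And>\<phi>. \<phi> \<in> RR I \<Longrightarrow> T \<phi> \<in> RR I"
    and lin: "\<And>\<phi> \<psi> \<alpha> \<beta>. \<phi> \<in> RR I \<Longrightarrow> \<psi> \<in> RR I \<Longrightarrow>
      ae_eq_on I (T (\<lambda>t. \<alpha> * \<phi> t + \<beta> * \<psi> t)) (\<lambda>t. \<alpha> * T \<phi> t + \<beta> * T \<psi> t)"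
    and ae: "\<And>\<phi> \<psi>. \<phi> \<in> RR I \<Longrightarrow> \<psi> \<in> RR I \<Longrightarrow> ae_eq_on I \<phi> \<psi> \<Longrightarrow> ae_eq_on I (T \<phi>) (T \<psi>)"
    and bdd: "\<And>J. inner_interval I J \<Longrightarrow> \<exists>J'. inner_interval I J' \<and> (\<forall>k. \<exists>m. \<exists>C>0.
      \<forall>\<phi>\<in>RR_on I J. T \<phi> \<in> RR_on I J' \<and> knorm I k (T \<phi>) \<le> C * knorm I m \<phi>)"
  shows "(\<lambda>\<phi>. f (T \<phi>)) \<in> RR_dual I"
proof (rule RR_dualI[OF assms(1)])
  fix \<phi> \<psi> :: "real \<Rightarrow> complex" and \<alpha> \<beta> :: complex
  assume *: "\<phi> \<in> RR I" "\<psi> \<in> RR I"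
  then have "f (T (\<lambda>t. \<alpha> * \<phi> t + \<beta> * \<psi> t)) = f (\<lambda>t. \<alpha> * T \<phi> t + \<beta> * T \<psi> t)"
    by (intro RR_dual_ae[OF assms(2)] lin T RR_lincomb)
  also have "\<dots> = \<alpha> * f (T \<phi>) + \<beta> * f (T \<psi>)"
    by (intro RR_dual_lin[OF assms(2)] T *)
  finally show "f (T (\<lambda>t. \<alpha> * \<phi> t + \<beta> * \<psi> t)) = \<alpha> * f (T \<phi>) + \<beta> * f (T \<psi>)" .
next
  fix \<phi> \<psi> assume "\<phi> \<in> RR I" "\<psi> \<in> RR I" "ae_eq_on I \<phi> \<psi>"
  then show "f (T \<phi>) = f (T \<psi>)" by (intro RR_dual_ae[OF assms(2)] ae T)
next
  fix J assume "inner_interval I J"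
  then obtain J' where J': "inner_interval I J'" and est: "\<And>k. \<exists>m. \<exists>C>0.
      \<forall>\<phi>\<in>RR_on I J. T \<phi> \<in> RR_on I J' \<and> knorm I k (T \<phi>) \<le> C * knorm I m \<phi>"
    using bdd by blast
  obtain k \<epsilon> where k: "\<epsilon> > 0" "\<And>\<phi>. \<phi> \<in> RR_on I J' \<Longrightarrow> knorm I k \<phi> < \<epsilon> \<Longrightarrow> cmod (f \<phi>) < 1"
    using RR_dual_bounded[OF assms(1,2) J'] by blast
  obtain m C where C: "C > 0"
    "\<forall>\<phi>\<in>RR_on I J. T \<phi> \<in> RR_on I J' \<and> knorm I k (T \<phi>) \<le> C * knorm I m \<phi>"
    using est by blast
  have "cmod (f (T \<phi>)) < 1" if \<phi>: "\<phi> \<in> RR_on I J" "knorm I m \<phi> < \<epsilon> / C" for \<phi>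
  proof (rule k(2))
    show "T \<phi> \<in> RR_on I J'" using C \<phi> by blast
    have "knorm I k (T \<phi>) \<le> C * knorm I m \<phi>" using C \<phi> by blast
    also have "\<dots> < \<epsilon>" using \<phi>(2) C(1) by (simp add: field_simps)
    finally show "knorm I k (T \<phi>) < \<epsilon>" .
  qed
  then show "\<exists>k. \<exists>\<epsilon>>0. \<forall>\<phi>\<in>RR_on I J. knorm I k \<phi> < \<epsilon> \<longrightarrow> cmod (f (T \<phi>)) < 1"
    using k(1) C(1) by (intro exI[of _ m] exI[of _ "\<epsilon> / C"]) auto
qed

lemma RR_dual_add: "f \<in> RR_dual I \<Longrightarrow> g \<in> RR_dual I \<Longrightarrow> (\<lambda>\<phi>. f \<phi> + g \<phi>) \<in> RR_dual I"
  unfolding RR_dual_def mem_Collect_eq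
  by (elim conjE, intro conjI continuous_map_add ballI allI impI) (simp_all add: algebra_simps)

lemma RR_dual_minus: "f \<in> RR_dual I \<Longrightarrow> (\<lambda>\<phi>. - f \<phi>) \<in> RR_dual I"
  unfolding RR_dual_def mem_Collect_eq
  by (elim conjE, intro conjI continuous_map_minus ballI allI impI) simp_all

section \<open>Differentiation as a continuous operator on test functions\<close>

lemma gderiv_ae_cong:
  assumes "open I" "\<phi> \<in> GG_inf I" "\<psi> \<in> GG_inf I" "ae_eq_on I \<phi> \<psi>"
  shows "ae_eq_on I (gderiv I \<phi>) (gderiv I \<psi>)"
  using assms by (metis GG_inf_is_gderiv is_gderiv_cong is_gderiv_unique)

text \<open>Around a point of \<open>I - C\<close> the function vanishes almost everywhere, so its
  difference quotients are eventually 0 and so are the one-sided values of the derivative.\<close>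

lemma gderiv_RR_on:
  assumes "open I" "closed C" "\<phi> \<in> RR_on I C"
  shows "gderiv I \<phi> \<in> RR_on I C"
proof -
  have G: "\<phi> \<in> GG_inf I" using assms(3) by (simp add: RR_on_def)
  have "AE t in lebesgue. t \<in> I - C \<longrightarrow> gderiv I \<phi> t = 0"
  proof (rule GG_AE_0[of _ I])
    show "gderiv I \<phi> \<in> GG I" using GG_inf_is_gderiv[OF assms(1) G] by (simp add: is_gderiv_def)
    fix t assume t: "t \<in> I - C"
    have "AE s in lebesgue. s \<in> I - C \<longrightarrow> \<phi> s = 0"
      using assms(3) unfolding RR_on_def AE_lebesgue_on_iff[OF assms(1)] by (auto elim: eventually_mono)
    note ev = AE_eventually_ess_at[OF this open_Diff[OF assms(1,2)] t]
    have "((\<lambda>s. (\<phi> s - left_val \<phi> t) / complex_of_real (s - t)) \<longlongrightarrow> left_val (gderiv I \<phi>) t) (ess_at_left t)"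
      "((\<lambda>s. (\<phi> s - right_val \<phi> t) / complex_of_real (s - t)) \<longlongrightarrow> right_val (gderiv I \<phi>) t) (ess_at_right t)"
      using GG_inf_is_gderiv[OF assms(1) G] t by (auto simp: is_gderiv_def)
    moreover have "((\<lambda>s. (\<phi> s - left_val \<phi> t) / complex_of_real (s - t)) \<longlongrightarrow> 0) (ess_at_left t)"
      "((\<lambda>s. (\<phi> s - right_val \<phi> t) / complex_of_real (s - t)) \<longlongrightarrow> 0) (ess_at_right t)"
      using RR_on_vals_0[OF assms t] ev by (auto intro!: tendsto_eventually elim: eventually_mono)
    ultimately show "left_val (gderiv I \<phi>) t = 0" "right_val (gderiv I \<phi>) t = 0"
      by (auto intro: tendsto_unique[OF ess_at_left_not_bot] tendsto_unique[OF ess_at_right_not_bot])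
  qed (use assms in auto)
  then show ?thesis
    using gderiv_GG_inf[OF assms(1) G] unfolding RR_on_def AE_lebesgue_on_iff[OF assms(1)]
    by (auto elim: eventually_mono)
qed

lemma gderiv_RR:
  assumes "open I" "is_interval I" "t \<in> I" "\<phi> \<in> RR I"
  shows "gderiv I \<phi> \<in> RR I"
proof -
  obtain c d where "inner_interval I {c..d}" "\<phi> \<in> RR_on I {c..d}"
    using assms by (rule RR_on_Icc)
  then have "gderiv I \<phi> \<in> RR_on I {c..d}" by (intro gderiv_RR_on[OF assms(1)]) auto
  then show ?thesis using RR_on_subset_RR[OF assms(1) \<open>inner_interval I {c..d}\<close>] by blast
qed

lemma knorm_gderiv_le: "knorm I k (gderiv I \<phi>) \<le> knorm I (Suc k) \<phi>"
proof (rule knorm_le)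
  fix i assume "i \<le> k"
  then show "Linf_norm I (gderivs I i (gderiv I \<phi>)) \<le> knorm I (Suc k) \<phi>"
    unfolding gderivs_gderiv by (intro Linf_norm_le_knorm) auto
qed

lemma RR_dual_comp_gderiv:
  assumes "open I" "is_interval I" "t \<in> I" "f \<in> RR_dual I"
  shows "(\<lambda>\<phi>. f (gderiv I \<phi>)) \<in> RR_dual I"
proof (rule RR_dual_comp[OF assms(1,4)])
  fix J assume "inner_interval I J"
  \<comment> \<open>\<open>J\<close> need not be closed, whereas \<open>gderiv_RR_on\<close> works
    on closed sets.\<close>
  then obtain c d where cd: "J \<subseteq> {c..d}" "inner_interval I {c..d}"
    using inner_interval_hull[OF assms(2) _ assms(3)] by metis
  then have "gderiv I \<phi> \<in> RR_on I {c..d}" if "\<phi> \<in> RR_on I J" for \<phi>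
    using that RR_on_mono[OF cd(1)] by (intro gderiv_RR_on[OF assms(1)]) auto
  then show "\<exists>J'. inner_interval I J' \<and> (\<forall>k. \<exists>m. \<exists>C>0.
      \<forall>\<phi>\<in>RR_on I J. gderiv I \<phi> \<in> RR_on I J' \<and> knorm I k (gderiv I \<phi>) \<le> C * knorm I m \<phi>)"
    using cd(2) knorm_gderiv_le
    by (intro exI[of _ "{c..d}"] conjI allI exI[of _ "Suc _"] exI[of _ 1]) auto
next
  fix \<phi> \<psi> :: "real \<Rightarrow> complex" and \<alpha> \<beta> :: complex
  assume "\<phi> \<in> RR I" "\<psi> \<in> RR I"
  then show "ae_eq_on I (gderiv I (\<lambda>t. \<alpha> * \<phi> t + \<beta> * \<psi> t)) (\<lambda>t. \<alpha> * gderiv I \<phi> t + \<beta> * gderiv I \<psi> t)"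
    using gderivs_lincomb[OF assms(1), of \<phi> \<psi> 1] by (simp add: RR_def)
next
  show "gderiv I \<phi> \<in> RR I" if "\<phi> \<in> RR I" for \<phi>
    by (rule gderiv_RR[OF assms(1-3) that])
  show "ae_eq_on I (gderiv I \<phi>) (gderiv I \<psi>)" if "\<phi> \<in> RR I" "\<psi> \<in> RR I" "ae_eq_on I \<phi> \<psi>" for \<phi> \<psi>
    using that by (intro gderiv_ae_cong[OF assms(1)]) (auto simp: RR_def)
qed


section \<open>Step functions\<close>

definition step :: "real \<Rightarrow> real \<Rightarrow> complex" where
  "step s t = (if s < t then 1 else 0)"

text \<open>The two conditions differ only at \<open>t = s\<close>, where the left side sees the
  value 0 and the right side the value 1.\<close>

lemma step_eventually:
  "eventually (\<lambda>u. step s u = (if s < t then 1 else 0)) (ess_at_left t)"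
  "eventually (\<lambda>u. step s u = (if s \<le> t then 1 else 0)) (ess_at_right t)"
proof -
  have "eventually (\<lambda>u. step s u = (if s < t then 1 else 0)) (at_left t)"
    unfolding eventually_at_left_field step_def
    by (cases "s < t") (auto intro: exI[of _ s] exI[of _ "t - 1"])
  moreover have "eventually (\<lambda>u. step s u = (if s \<le> t then 1 else 0)) (at_right t)"
    unfolding eventually_at_right_field step_def
    by (cases "s \<le> t") (auto intro: exI[of _ s] exI[of _ "t + 1"])
  ultimately show "eventually (\<lambda>u. step s u = (if s < t then 1 else 0)) (ess_at_left t)"
    "eventually (\<lambda>u. step s u = (if s \<le> t then 1 else 0)) (ess_at_right t)"
    using filter_leD[OF ess_at_left_le] filter_leD[OF ess_at_right_le] by blast+
qed

lemma step_vals: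
  "left_val (step s) t = (if s < t then 1 else 0)" "right_val (step s) t = (if s \<le> t then 1 else 0)"
  using left_val_cong[OF step_eventually(1)] right_val_cong[OF step_eventually(2)]
  by (simp_all add: vals_const)

lemma step_GG: "step s \<in> GG I"
proof -
  have "step s \<in> borel_measurable borel" unfolding step_def by measurable
  then have m: "step s \<in> borel_measurable (lebesgue_on I)"
    by (intro measurable_restrict_space1 measurable_completion) simp
  moreover have "\<exists>C. AE t in lebesgue_on I. cmod (step s t) \<le> C"
    by (intro exI[of _ 1] AE_I2) (simp add: step_def)
  ultimately show ?thesis
    unfolding GG_def
    using esssup_less_infinity_iff[OF m] step_eventually[THEN tendsto_eventually] by blast
qed

lemma is_gderiv_step: "is_gderiv I (step s) (\<lambda>_. 0)"
  unfolding is_gderiv_def vals_const step_vals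
proof (intro conjI ballI zero_GG)
  fix t
  show "((\<lambda>u. (step s u - (if s < t then 1 else 0)) / complex_of_real (u - t)) \<longlongrightarrow> 0) (ess_at_left t)"
    by (rule tendsto_eventually, rule eventually_mono[OF step_eventually(1)[of s t]]) simp
  show "((\<lambda>u. (step s u - (if s \<le> t then 1 else 0)) / complex_of_real (u - t)) \<longlongrightarrow> 0) (ess_at_right t)"
    by (rule tendsto_eventually, rule eventually_mono[OF step_eventually(2)[of s t]]) simp
qed

lemma step_GG_inf: "step s \<in> GG_inf I"
  by (rule GG_inf_antiderivative[OF step_GG is_gderiv_step zero_GG_inf])

text \<open>A single step at a point of \<open>I\<close> stays 1 up to the right end of
  \<open>I\<close>; the difference of two vanishes outside the interval between their
  positions.\<close>

lemma step_diff_RR: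
  assumes "open I" "is_interval I" "r \<in> I" "s \<in> I"
  shows "(\<lambda>t. step s t - step r t) \<in> RR I"
proof -
  have "(\<lambda>t. step s t - step r t) \<in> GG_inf I"
    using GG_inf_lincomb[OF step_GG_inf step_GG_inf, of 1 s "-1" r] by simp
  moreover have "step s t - step r t = 0" if "t \<notin> {min r s..max r s}" for t
    using that by (auto simp: step_def)
  ultimately have "(\<lambda>t. step s t - step r t) \<in> RR_on I {min r s..max r s}"
    unfolding RR_on_def by blast
  moreover have "inner_interval I {min r s..max r s}"
    using assms by (intro inner_interval_Icc) (auto simp: min_def max_def)
  ultimately show ?thesis using RR_on_subset_RR[OF assms(1)] by blast
qed


section \<open>Primitives\<close>

text \<open>The factor \<open>indicator I\<close> removes the arbitrary values of a representative
  outside \<open>I\<close>, so the integral effectively starts at the left end of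
  \<open>I\<close>.\<close>

definition primitive :: "real set \<Rightarrow> (real \<Rightarrow> complex) \<Rightarrow> real \<Rightarrow> complex" where
  "primitive I g t = (LINT s|lebesgue. indicator {..t} s *\<^sub>R (indicator I s *\<^sub>R g s))"

definition total_integral :: "real set \<Rightarrow> (real \<Rightarrow> complex) \<Rightarrow> complex" where
  "total_integral I g = (LINT s|lebesgue. indicator I s *\<^sub>R g s)"

lemma GG_measurable:
  assumes "open I" "g \<in> GG I"
  shows "(\<lambda>s. indicator I s *\<^sub>R g s) \<in> borel_measurable lebesgue"
proof -
  have "I \<inter> space lebesgue \<in> sets lebesgue" using assms(1) by auto
  from borel_measurable_restrict_space_iff[OF this, of g] show ?thesis
    using assms(2) by (simp add: GG_def)
qed

text \<open>Size and support are packed into one dominating function, which is integrable when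
  \<open>J\<close> is a compact interval.\<close>

lemma RR_on_AE_bound:
  assumes "open I" "g \<in> RR_on I J"
  shows "AE s in lebesgue. norm (indicator I s *\<^sub>R g s) \<le> indicator J s *\<^sub>R Linf_norm I g"
proof -
  have "g \<in> GG I" using assms(2) by (simp add: RR_on_def GG_inf_def)
  then have "AE s in lebesgue. s \<in> I \<longrightarrow> cmod (g s) \<le> Linf_norm I g"
    using Linf_norm_AE[of g I] unfolding AE_lebesgue_on_iff[OF assms(1)] by blast
  moreover have "AE s in lebesgue. s \<in> I \<longrightarrow> s \<notin> J \<longrightarrow> g s = 0"
    using assms(2) unfolding RR_on_def AE_lebesgue_on_iff[OF assms(1)] by blast
  ultimately show ?thesis
    by eventually_elim (auto simp: indicator_def Linf_norm_nonneg)
qed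

lemma RR_on_integrable:
  assumes "open I" "g \<in> RR_on I {c..d}"
  shows "integrable lebesgue (\<lambda>s. indicator I s *\<^sub>R g s)"
proof (rule Bochner_Integration.integrable_bound[OF _ _ RR_on_AE_bound[OF assms, THEN eventually_mono]])
  show "integrable lebesgue (\<lambda>s. indicator {c..d} s *\<^sub>R Linf_norm I g)"
    by (intro integrable_scaleR_left) (simp add: integrable_indicator_iff emeasure_lborel_Icc_eq)
  show "(\<lambda>s. indicator I s *\<^sub>R g s) \<in> borel_measurable lebesgue"
    using assms by (intro GG_measurable) (auto simp: RR_on_def GG_inf_def)
qed auto

lemma integral_norm_AE_bound:
  fixes f :: "real \<Rightarrow> complex"
  assumes "integrable lebesgue f" "integrable lebesgue h" "AE s in lebesgue. norm (f s) \<le> h s"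
  shows "norm (LINT s|lebesgue. f s) \<le> (LINT s|lebesgue. h s)"
  by (rule order_trans[OF integral_norm_bound integral_mono_AE]) (use assms in auto)

lemma integrable_restrict_atMost:
  fixes f :: "real \<Rightarrow> complex"
  shows "integrable lebesgue f \<Longrightarrow> integrable lebesgue (\<lambda>s. indicator {..t} s *\<^sub>R f s)"
  by (rule integrable_mult_indicator) auto

lemma primitive_norm_le:
  assumes "open I" "g \<in> RR_on I {c..d}" "c \<le> d"
  shows "norm (primitive I g t) \<le> (d - c) * Linf_norm I g" "norm (total_integral I g) \<le> (d - c) * Linf_norm I g"
proof -
  have i: "integrable lebesgue (\<lambda>s. indicator {c..d} s *\<^sub>R Linf_norm I g)"
    by (intro integrable_scaleR_left) (simp add: integrable_indicator_iff emeasure_lborel_Icc_eq)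
  have v: "(LINT s|lebesgue. indicator {c..d} s *\<^sub>R Linf_norm I g) = (d - c) * Linf_norm I g"
    using assms(3) by (simp add: measure_lborel_Icc)
  note b = RR_on_AE_bound[OF assms(1,2)]
  show "norm (primitive I g t) \<le> (d - c) * Linf_norm I g"
    unfolding primitive_def v[symmetric]
    using b by (intro integral_norm_AE_bound i integrable_restrict_atMost RR_on_integrable[OF assms(1,2)])
      (auto elim!: eventually_mono simp: indicator_def Linf_norm_nonneg split: if_splits)
  show "norm (total_integral I g) \<le> (d - c) * Linf_norm I g"
    unfolding total_integral_def v[symmetric]
    using b by (intro integral_norm_AE_bound i RR_on_integrable[OF assms(1,2)])
qed

text \<open>The increment is compared with that of a function of constant slope \<open>l\<close>.
  Taking \<open>l = 0\<close> yields the Lipschitz bound, and taking \<open>l\<close> to be a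
  one-sided value of \<open>g\<close> yields the derivative.\<close>

lemma primitive_increment:
  assumes int: "integrable lebesgue (\<lambda>s. indicator I s *\<^sub>R g s)" and "u \<le> v"
    and le: "AE s in lebesgue. u < s \<longrightarrow> s < v \<longrightarrow> norm (indicator I s *\<^sub>R g s - l) \<le> e"
  shows "norm (primitive I g v - primitive I g u - l * of_real (v - u)) \<le> e * (v - u)"
proof -
  let ?g = "\<lambda>s. indicator I s *\<^sub>R g s"
  have c: "integrable lebesgue (\<lambda>s. indicator {u<..<v} s *\<^sub>R k)"
    "(LINT s|lebesgue. indicator {u<..<v} s *\<^sub>R k) = (v - u) *\<^sub>R k" for k :: "'c::euclidean_space"
    using \<open>u \<le> v\<close> by (auto simp: integrable_indicator_iff intro!: integrable_scaleR_left)
  \<comment> \<open>Subtracting the two half-line integrals leaves the interval open at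
    \<open>u\<close> and closed at \<open>v\<close>; dropping the null point \<open>v\<close> makes
    it open.\<close>
  have ne: "AE s in lebesgue. s \<noteq> v"
    using AE_not_in[of "{v}" lebesgue] by (simp add: null_sets_completionI)
  have ig: "integrable lebesgue (\<lambda>s. indicator {u<..<v} s *\<^sub>R ?g s)"
    by (rule integrable_mult_indicator[OF _ int]) simp
  have "primitive I g v - primitive I g u =
      (LINT s|lebesgue. indicator {..v} s *\<^sub>R ?g s - indicator {..u} s *\<^sub>R ?g s)"
    unfolding primitive_def
    by (rule Bochner_Integration.integral_diff[symmetric]) (rule integrable_restrict_atMost[OF int])+
  also have "\<dots> = (LINT s|lebesgue. indicator {u<..<v} s *\<^sub>R ?g s)"
  proof (rule integral_cong_AE)
    show "AE s in lebesgue. indicator {..v} s *\<^sub>R ?g s - indicator {..u} s *\<^sub>R ?g s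
        = indicator {u<..<v} s *\<^sub>R ?g s"
      using ne by eventually_elim (use \<open>u \<le> v\<close> in \<open>auto simp: indicator_def\<close>)
  qed (use integrable_restrict_atMost[OF int] ig in \<open>auto intro!: borel_measurable_diff borel_measurable_integrable\<close>)
  finally have diff: "primitive I g v - primitive I g u = (LINT s|lebesgue. indicator {u<..<v} s *\<^sub>R ?g s)" .
  have "l * of_real (v - u) = (LINT s|lebesgue. indicator {u<..<v} s *\<^sub>R l)"
    unfolding c(2) by (simp only: scaleR_conv_of_real mult.commute)
  then have "primitive I g v - primitive I g u - l * of_real (v - u) =
      (LINT s|lebesgue. indicator {u<..<v} s *\<^sub>R ?g s - indicator {u<..<v} s *\<^sub>R l)"
    unfolding diff by (simp only: Bochner_Integration.integral_diff[OF ig c(1)])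
  also have "norm \<dots> \<le> (LINT s|lebesgue. indicator {u<..<v} s *\<^sub>R e)"
    using le by (intro integral_norm_AE_bound Bochner_Integration.integrable_diff ig c)
      (auto elim!: eventually_mono simp: indicator_def)
  also have "\<dots> = e * (v - u)" using c(2)[of e] by simp
  finally show ?thesis .
qed

lemma primitive_lipschitz:
  assumes "open I" "g \<in> RR_on I {c..d}"
  shows "norm (primitive I g v - primitive I g u) \<le> Linf_norm I g * \<bar>v - u\<bar>"
proof -
  have b: "AE s in lebesgue. norm (indicator I s *\<^sub>R g s - 0) \<le> Linf_norm I g"
    using RR_on_AE_bound[OF assms]
    by (rule eventually_mono) (auto simp: indicator_def Linf_norm_nonneg split: if_splits split_of_bool_asm)
  have "norm (primitive I g v - primitive I g u) \<le> Linf_norm I g * (v - u)" if "u \<le> v" for u v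
    using primitive_increment[OF RR_on_integrable[OF assms] that, of 0 "Linf_norm I g"] eventually_mono[OF b] by simp
  from this[of u v] this[of v u] show ?thesis
    by (cases "u \<le> v") (auto simp: norm_minus_commute)
qed

lemma primitive_isCont:
  assumes "open I" "g \<in> RR_on I {c..d}"
  shows "isCont (primitive I g) t"
  unfolding isCont_def
proof (rule Lim_null_comparison[THEN Lim_null[THEN iffD2]])
  show "eventually (\<lambda>s. norm (primitive I g s - primitive I g t) \<le> Linf_norm I g * \<bar>s - t\<bar>) (at t)"
    using primitive_lipschitz[OF assms] by simp
  have "((\<lambda>s. Linf_norm I g * \<bar>s - t\<bar>) \<longlongrightarrow> Linf_norm I g * \<bar>t - t\<bar>) (at t)"
    by (intro tendsto_intros)
  then show "((\<lambda>s. Linf_norm I g * \<bar>s - t\<bar>) \<longlongrightarrow> 0) (at t)" by simp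
qed

lemma primitive_tendsto:
  assumes "open I" "g \<in> RR_on I {c..d}"
  shows "(primitive I g \<longlongrightarrow> primitive I g t) (ess_at_left t)"
    "(primitive I g \<longlongrightarrow> primitive I g t) (ess_at_right t)"
proof -
  have *: "(primitive I g \<longlongrightarrow> primitive I g t) (at t)"
    using primitive_isCont[OF assms] by (simp add: isCont_def)
  show "(primitive I g \<longlongrightarrow> primitive I g t) (ess_at_left t)"
    "(primitive I g \<longlongrightarrow> primitive I g t) (ess_at_right t)"
    by (rule tendsto_mono[OF ess_at_left_le_at *], rule tendsto_mono[OF ess_at_right_le_at *])
qed

lemma primitive_GG:
  assumes "open I" "g \<in> RR_on I {c..d}" "c \<le> d"
  shows "primitive I g \<in> GG I"
proof -
  have "primitive I g \<in> borel_measurable borel"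
    using primitive_isCont[OF assms(1,2)]
    by (intro borel_measurable_continuous_onI) (simp add: continuous_at_imp_continuous_on)
  then have m: "primitive I g \<in> borel_measurable (lebesgue_on I)"
    by (intro measurable_restrict_space1 measurable_completion) simp
  moreover have "\<exists>C. AE t in lebesgue_on I. cmod (primitive I g t) \<le> C"
    using primitive_norm_le(1)[OF assms] by blast
  ultimately show ?thesis
    unfolding GG_def using esssup_less_infinity_iff[OF m] primitive_tendsto[OF assms(1,2)] by blast
qed

text \<open>A one-sided fundamental theorem of calculus: close to \<open>t\<close> on one side,
  \<open>g\<close> is within \<open>e / 2\<close> of its one-sided value almost everywhere, and so
  is the mean of \<open>g\<close> over the interval between \<open>s\<close> and \<open>t\<close>.
  Halving \<open>e\<close> leaves room for the strict inequality.\<close>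

lemma is_gderiv_primitive:
  assumes "open I" "g \<in> RR_on I {c..d}"
  shows "is_gderiv I (primitive I g) g"
  unfolding is_gderiv_def
proof (intro conjI ballI)
  show G: "g \<in> GG I" using assms(2) by (simp add: RR_on_def GG_inf_def)
  fix t assume t: "t \<in> I"
  obtain r where r: "r > 0" "ball t r \<subseteq> I" using assms(1) t open_contains_ball by blast
  then have rI: "s \<in> I" if "\<bar>s - t\<bar> < r" for s using that by (auto simp: dist_real_def abs_minus_commute)
  note vals = left_val_eqI[OF primitive_tendsto(1)[OF assms]] right_val_eqI[OF primitive_tendsto(2)[OF assms]]
  note incr = primitive_increment[OF RR_on_integrable[OF assms]]
  show "((\<lambda>s. (primitive I g s - left_val (primitive I g) t) / complex_of_real (s - t)) \<longlongrightarrow> left_val g t) (ess_at_left t)"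
    unfolding vals
  proof (rule tendstoI)
    fix e :: real assume "e > 0"
    then have "eventually (\<lambda>s. dist (g s) (left_val g t) < e / 2) (ess_at_left t)"
      using tendstoD[OF GG_tendsto_left[OF G t], of "e / 2"] by simp
    then obtain b where b: "b < t" "AE s in lebesgue. b < s \<longrightarrow> s < t \<longrightarrow> dist (g s) (left_val g t) < e / 2"
      unfolding eventually_ess_at_left by blast
    have "dist ((primitive I g s - primitive I g t) / complex_of_real (s - t)) (left_val g t) < e"
      \<comment> \<open>The bound \<open>t - r\<close> keeps everything inside \<open>I\<close>,
        where the indicator is 1.\<close>
      if s: "max b (t - r) < s" "s < t" for s
    proof -
      have "AE u in lebesgue. s < u \<longrightarrow> u < t \<longrightarrow> norm (indicator I u *\<^sub>R g u - left_val g t) \<le> e / 2"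
        using b(2) by (rule eventually_mono) (use s rI in \<open>auto simp: dist_norm indicator_def abs_if\<close>)
      from incr[OF _ this] s
      have "norm (primitive I g t - primitive I g s - left_val g t * of_real (t - s)) \<le> e / 2 * (t - s)"
        by simp
      \<comment> \<open>\<open>primitive_increment\<close> runs from the smaller to the larger
        point, here from \<open>s\<close> to \<open>t\<close>, so numerator and denominator are both
        negated.\<close>
      moreover have "(primitive I g s - primitive I g t) / complex_of_real (s - t) - left_val g t =
          (primitive I g t - primitive I g s - left_val g t * of_real (t - s)) / complex_of_real (t - s)"
        using s by (simp add: divide_simps) (simp add: algebra_simps)
      ultimately have "dist ((primitive I g s - primitive I g t) / complex_of_real (s - t)) (left_val g t) \<le> e / 2"
        using s by (simp add: dist_norm norm_divide pos_divide_le_eq del: of_real_diff)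
      with \<open>e > 0\<close> show ?thesis by simp
    qed
    then show "eventually (\<lambda>s. dist ((primitive I g s - primitive I g t) / complex_of_real (s - t)) (left_val g t) < e) (ess_at_left t)"
      unfolding eventually_ess_at_left using b(1) r(1)
      by (intro exI[of _ "max b (t - r)"] conjI) auto
  qed
  show "((\<lambda>s. (primitive I g s - right_val (primitive I g) t) / complex_of_real (s - t)) \<longlongrightarrow> right_val g t) (ess_at_right t)"
    unfolding vals
  proof (rule tendstoI)
    fix e :: real assume "e > 0"
    then have "eventually (\<lambda>s. dist (g s) (right_val g t) < e / 2) (ess_at_right t)"
      using tendstoD[OF GG_tendsto_right[OF G t], of "e / 2"] by simp
    then obtain b where b: "b > t" "AE s in lebesgue. t < s \<longrightarrow> s < b \<longrightarrow> dist (g s) (right_val g t) < e / 2"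
      unfolding eventually_ess_at_right by blast
    have "dist ((primitive I g s - primitive I g t) / complex_of_real (s - t)) (right_val g t) < e"
      if s: "s < min b (t + r)" "t < s" for s
    proof -
      have "AE u in lebesgue. t < u \<longrightarrow> u < s \<longrightarrow> norm (indicator I u *\<^sub>R g u - right_val g t) \<le> e / 2"
        using b(2) by (rule eventually_mono) (use s rI in \<open>auto simp: dist_norm indicator_def abs_if\<close>)
      from incr[OF _ this] s
      have "norm (primitive I g s - primitive I g t - right_val g t * of_real (s - t)) \<le> e / 2 * (s - t)"
        by simp
      moreover have "(primitive I g s - primitive I g t) / complex_of_real (s - t) - right_val g t =
          (primitive I g s - primitive I g t - right_val g t * of_real (s - t)) / complex_of_real (s - t)"
        using s by (simp add: divide_simps)
      ultimately have "dist ((primitive I g s - primitive I g t) / complex_of_real (s - t)) (right_val g t) \<le> e / 2"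
        using s by (simp add: dist_norm norm_divide pos_divide_le_eq del: of_real_diff)
      with \<open>e > 0\<close> show ?thesis by simp
    qed
    then show "eventually (\<lambda>s. dist ((primitive I g s - primitive I g t) / complex_of_real (s - t)) (right_val g t) < e) (ess_at_right t)"
      unfolding eventually_ess_at_right using b(1) r(1)
      by (intro exI[of _ "min b (t + r)"] conjI) auto
  qed
qed

lemma primitive_lincomb:
  assumes "integrable lebesgue (\<lambda>s. indicator I s *\<^sub>R g s)" "integrable lebesgue (\<lambda>s. indicator I s *\<^sub>R h s)"
  shows "primitive I (\<lambda>s. \<alpha> * g s + \<beta> * h s) t = \<alpha> * primitive I g t + \<beta> * primitive I h t"
    "total_integral I (\<lambda>s. \<alpha> * g s + \<beta> * h s) = \<alpha> * total_integral I g + \<beta> * total_integral I h"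
proof -
  have "integrable lebesgue (\<lambda>s. \<alpha> * (indicator {..t} s *\<^sub>R (indicator I s *\<^sub>R g s)))"
    "integrable lebesgue (\<lambda>s. \<beta> * (indicator {..t} s *\<^sub>R (indicator I s *\<^sub>R h s)))"
    by (intro integrable_mult_right integrable_restrict_atMost assms)+
  from Bochner_Integration.integral_add[OF this]
  show "primitive I (\<lambda>s. \<alpha> * g s + \<beta> * h s) t = \<alpha> * primitive I g t + \<beta> * primitive I h t"
    unfolding primitive_def integral_mult_right_zero by (simp add: scaleR_add_right)
  have "integrable lebesgue (\<lambda>s. \<alpha> * (indicator I s *\<^sub>R g s))"
    "integrable lebesgue (\<lambda>s. \<beta> * (indicator I s *\<^sub>R h s))"
    by (intro integrable_mult_right assms)+
  from Bochner_Integration.integral_add[OF this]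
  show "total_integral I (\<lambda>s. \<alpha> * g s + \<beta> * h s) = \<alpha> * total_integral I g + \<beta> * total_integral I h"
    unfolding total_integral_def integral_mult_right_zero by (simp add: scaleR_add_right)
qed

lemma primitive_cong:
  assumes "open I" "ae_eq_on I g h" "integrable lebesgue (\<lambda>s. indicator I s *\<^sub>R g s)"
    "integrable lebesgue (\<lambda>s. indicator I s *\<^sub>R h s)"
  shows "primitive I g t = primitive I h t" "total_integral I g = total_integral I h"
proof -
  have ae: "AE s in lebesgue. s \<in> I \<longrightarrow> g s = h s"
    using assms(2) unfolding ae_eq_on_def AE_lebesgue_on_iff[OF assms(1)] .
  show "primitive I g t = primitive I h t"
    unfolding primitive_def
    by (rule integral_cong_AE)
       (use ae assms(3,4)[THEN integrable_restrict_atMost] in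
        \<open>auto elim!: eventually_mono intro!: borel_measurable_integrable simp: indicator_def\<close>)
  show "total_integral I g = total_integral I h"
    unfolding total_integral_def
    by (rule integral_cong_AE)
       (use ae assms(3,4) in \<open>auto elim!: eventually_mono intro!: borel_measurable_integrable simp: indicator_def\<close>)
qed

text \<open>Left of \<open>c\<close> the truncated integrand is 0 almost everywhere, and right of
  \<open>d\<close> the truncation changes nothing.\<close>

lemma primitive_outside:
  assumes "open I" "g \<in> RR_on I {c..d}"
  shows "t < c \<Longrightarrow> primitive I g t = 0" "d < t \<Longrightarrow> primitive I g t = total_integral I g"
proof -
  note b = RR_on_AE_bound[OF assms] and i = RR_on_integrable[OF assms]
  show "primitive I g t = 0" if "t < c"
    unfolding primitive_def
    by (rule integral_eq_zero_AE, rule eventually_mono[OF b]) (use that in \<open>auto simp: indicator_def split: if_splits\<close>)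
  show "primitive I g t = total_integral I g" if "d < t"
    unfolding primitive_def total_integral_def
  proof (rule integral_cong_AE)
    show "AE s in lebesgue. indicator {..t} s *\<^sub>R (indicator I s *\<^sub>R g s) = indicator I s *\<^sub>R g s"
      by (rule eventually_mono[OF b]) (use that in \<open>auto simp: indicator_def split: if_splits split_of_bool_asm\<close>)
  qed (use i integrable_restrict_atMost[OF i] in \<open>auto intro!: borel_measurable_integrable\<close>)
qed


text \<open>Beyond the support of \<open>g\<close> the primitive stays at the total integral. The
  step cancels this constant while affecting neither the derivative nor the jumps away from
  \<open>r\<close>.\<close>

definition cut_primitive :: "real set \<Rightarrow> real \<Rightarrow> (real \<Rightarrow> complex) \<Rightarrow> real \<Rightarrow> complex" where
  "cut_primitive I r g t = primitive I g t - total_integral I g * step r t"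

lemma cut_primitive_eq_lincomb:
  "cut_primitive I r g = (\<lambda>t. 1 * primitive I g t + (- total_integral I g) * step r t)"
  by (simp add: cut_primitive_def fun_eq_iff)

lemma is_gderiv_cut_primitive:
  assumes "open I" "g \<in> RR_on I {c..d}" "c \<le> d"
  shows "is_gderiv I (cut_primitive I r g) g" "cut_primitive I r g \<in> GG I"
proof -
  show "is_gderiv I (cut_primitive I r g) g"
    using is_gderiv_lincomb[OF primitive_GG[OF assms] is_gderiv_primitive[OF assms(1,2)]
        step_GG is_gderiv_step, of 1 "- total_integral I g" r]
    unfolding cut_primitive_eq_lincomb by simp
  show "cut_primitive I r g \<in> GG I"
    unfolding cut_primitive_eq_lincomb by (rule GG_lincomb[OF primitive_GG[OF assms] step_GG])
qed

lemma jump_cut_primitive: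
  assumes "open I" "g \<in> RR_on I {c..d}" "c \<le> d" "t \<in> I" "t \<noteq> r"
  shows "jump t (cut_primitive I r g) = 0"
  using assms(5) left_val_eqI[OF primitive_tendsto(1)[OF assms(1,2)]]
    right_val_eqI[OF primitive_tendsto(2)[OF assms(1,2)]]
  unfolding jump_def cut_primitive_eq_lincomb
    left_val_lincomb[OF primitive_GG[OF assms(1-3)] step_GG assms(4)]
    right_val_lincomb[OF primitive_GG[OF assms(1-3)] step_GG assms(4)] step_vals
  by simp

text \<open>Since \<open>r\<close> lies in \<open>{c..d}\<close>, the step is 0 to the left of
  \<open>c\<close> and 1 to the right of \<open>d\<close>, exactly where the primitive is 0 and the
  total integral respectively.\<close>

lemma cut_primitive_RR_on:
  assumes "open I" "g \<in> RR_on I {c..d}" "c \<le> r" "r \<le> d"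
  shows "cut_primitive I r g \<in> RR_on I {c..d}"
proof -
  have "c \<le> d" "g \<in> GG_inf I" using assms by (auto simp: RR_on_def)
  then have "cut_primitive I r g \<in> GG_inf I"
    using is_gderiv_cut_primitive[OF assms(1,2)] GG_inf_antiderivative by blast
  moreover have "cut_primitive I r g t = 0" if "t \<notin> {c..d}" for t
    using that assms(3,4) primitive_outside[OF assms(1,2), of t]
    by (cases "t < c") (auto simp: cut_primitive_def step_def)
  ultimately show ?thesis by (auto simp: RR_on_def)
qed

lemma cut_primitive_RR:
  assumes "open I" "is_interval I" "r \<in> I" "g \<in> RR I"
  shows "cut_primitive I r g \<in> RR I"
proof -
  obtain c d where "inner_interval I {c..d}" "g \<in> RR_on I {c..d}" "c \<le> r" "r \<le> d"
    using assms by (rule RR_on_Icc)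
  then show ?thesis
    using cut_primitive_RR_on[OF assms(1)] RR_on_subset_RR[OF assms(1)] by blast
qed

lemma RR_integrable:
  assumes "open I" "is_interval I" "r \<in> I" "g \<in> RR I"
  shows "integrable lebesgue (\<lambda>s. indicator I s *\<^sub>R g s)"
proof -
  obtain c d where "g \<in> RR_on I {c..d}" using assms by (rule RR_on_Icc)
  then show ?thesis by (rule RR_on_integrable[OF assms(1)])
qed

lemma cut_primitive_lincomb:
  assumes "open I" "is_interval I" "r \<in> I" "g \<in> RR I" "h \<in> RR I"
  shows "cut_primitive I r (\<lambda>s. \<alpha> * g s + \<beta> * h s) t =
    \<alpha> * cut_primitive I r g t + \<beta> * cut_primitive I r h t"
  using primitive_lincomb[OF RR_integrable RR_integrable, OF assms(1-4) assms(1-3,5)]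
  by (simp add: cut_primitive_def algebra_simps)

text \<open>At order 0 two integrals occur, each at most \<open>(d - c) * Linf_norm I g\<close>.
  Every higher derivative agrees almost everywhere with a derivative of \<open>g\<close> of one
  order less, which accounts for the 1 in the maximum.\<close>

lemma knorm_cut_primitive_le:
  assumes "open I" "g \<in> RR_on I {c..d}" "c \<le> d"
  shows "knorm I k (cut_primitive I r g) \<le> max 1 (2 * (d - c)) * knorm I k g"
proof (rule knorm_le)
  let ?C = "max 1 (2 * (d - c))"
  have G: "g \<in> GG_inf I" using assms(2) by (simp add: RR_on_def)
  fix i assume i: "i \<le> k"
  show "Linf_norm I (gderivs I i (cut_primitive I r g)) \<le> ?C * knorm I k g"
  proof (cases i)
    case 0
    have "cmod (cut_primitive I r g t) \<le> ?C * knorm I k g" for t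
    proof -
      have "cmod (cut_primitive I r g t) \<le> cmod (primitive I g t) + cmod (total_integral I g * step r t)"
        unfolding cut_primitive_def using norm_triangle_ineq4[of "primitive I g t" "total_integral I g * step r t"] by simp
      also have "cmod (total_integral I g * step r t) \<le> cmod (total_integral I g)" by (simp add: step_def)
      also have "cmod (primitive I g t) + cmod (total_integral I g) \<le> 2 * (d - c) * Linf_norm I g"
        using primitive_norm_le(1)[OF assms, of t] primitive_norm_le(2)[OF assms] by (simp add: algebra_simps)
      also have "\<dots> \<le> ?C * knorm I k g"
        using Linf_norm_le_knorm[of 0 k I g] Linf_norm_nonneg[of I g] by (intro mult_mono) auto
      finally show ?thesis by simp
    qed
    then show ?thesis
      using 0 is_gderiv_cut_primitive(2)[OF assms] knorm_nonneg[of I k g]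
      by (auto intro!: Linf_norm_le mult_nonneg_nonneg simp: le_max_iff_disj)
  next
    case (Suc j)
    let ?P = "cut_primitive I r g"
    have P: "is_gderiv I ?P g" "?P \<in> GG_inf I"
      using is_gderiv_cut_primitive[OF assms] GG_inf_antiderivative[OF _ _ G] by blast+
    have "ae_eq_on I (gderivs I i ?P) (gderivs I j g)"
      unfolding Suc gderivs_gderiv[symmetric]
      using GG_inf_gderivs(1)[OF assms(1) G] gderiv_ae_eq[OF assms(1) P(1)]
      by (intro gderivs_ae_eq_cong[OF assms(1), where d = "\<lambda>k. gderivs I k g"]) auto
    then have "AE s in lebesgue_on I. cmod (gderivs I i ?P s) \<le> knorm I k g"
      using Linf_norm_AE[OF GG_inf_gderivs(2)[OF assms(1) G, of j]] unfolding ae_eq_on_def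
    proof eventually_elim
      case (elim s)
      then show ?case using Linf_norm_le_knorm[of j k I g] i Suc by simp
    qed
    then have "Linf_norm I (gderivs I i ?P) \<le> knorm I k g"
      by (intro Linf_norm_le GG_inf_gderivs(2)[OF assms(1) P(2)] knorm_nonneg)
    also have "\<dots> \<le> ?C * knorm I k g"
      using mult_right_mono[of 1 ?C "knorm I k g"] knorm_nonneg[of I k g] by simp
    finally show ?thesis .
  qed
qed

lemma RR_dual_comp_cut_primitive:
  assumes "open I" "is_interval I" "r \<in> I" "f \<in> RR_dual I"
  shows "(\<lambda>\<phi>. f (cut_primitive I r \<phi>)) \<in> RR_dual I"
proof (rule RR_dual_comp[OF assms(1,4)])
  fix J assume "inner_interval I J"
  \<comment> \<open>The interval is enlarged to contain \<open>r\<close>, as the cut introduces a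
    jump there even if \<open>J\<close> is far away.\<close>
  then obtain c d where cd: "c \<le> r" "r \<le> d" "J \<subseteq> {c..d}" "inner_interval I {c..d}"
    using inner_interval_hull[OF assms(2) _ assms(3)] by metis
  have "cut_primitive I r \<phi> \<in> RR_on I {c..d} \<and>
      knorm I k (cut_primitive I r \<phi>) \<le> max 1 (2 * (d - c)) * knorm I k \<phi>" if "\<phi> \<in> RR_on I J" for \<phi> k
  proof -
    have "\<phi> \<in> RR_on I {c..d}" using that RR_on_mono[OF cd(3)] by blast
    then show ?thesis
      using cd by (intro conjI cut_primitive_RR_on knorm_cut_primitive_le assms(1)) auto
  qed
  then show "\<exists>J'. inner_interval I J' \<and> (\<forall>k. \<exists>m. \<exists>C>0. \<forall>\<phi>\<in>RR_on I J.
      cut_primitive I r \<phi> \<in> RR_on I J' \<and> knorm I k (cut_primitive I r \<phi>) \<le> C * knorm I m \<phi>)"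
    using cd(4) less_le_trans[OF zero_less_one max.cobounded1] by metis
next
  fix \<phi> \<psi> :: "real \<Rightarrow> complex" and \<alpha> \<beta> :: complex
  assume "\<phi> \<in> RR I" "\<psi> \<in> RR I"
  then show "ae_eq_on I (cut_primitive I r (\<lambda>t. \<alpha> * \<phi> t + \<beta> * \<psi> t))
      (\<lambda>t. \<alpha> * cut_primitive I r \<phi> t + \<beta> * cut_primitive I r \<psi> t)"
    using cut_primitive_lincomb[OF assms(1-3)] by (simp add: ae_eq_on_def)
next
  fix \<phi> \<psi> assume *: "\<phi> \<in> RR I" "\<psi> \<in> RR I" "ae_eq_on I \<phi> \<psi>"
  have i: "integrable lebesgue (\<lambda>s. indicator I s *\<^sub>R \<phi> s)" "integrable lebesgue (\<lambda>s. indicator I s *\<^sub>R \<psi> s)"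
    using * RR_integrable[OF assms(1-3)] by blast+
  show "ae_eq_on I (cut_primitive I r \<phi>) (cut_primitive I r \<psi>)"
    using primitive_cong[OF assms(1) *(3) i] by (simp add: ae_eq_on_def cut_primitive_def)
qed (rule cut_primitive_RR[OF assms(1-3)])


section \<open>Functions with zero derivative\<close>

lemma jump_lincomb:
  assumes "g \<in> GG I" "h \<in> GG I" "t \<in> I"
  shows "jump t (\<lambda>s. \<alpha> * g s + \<beta> * h s) = \<alpha> * jump t g + \<beta> * jump t h"
  unfolding jump_def left_val_lincomb[OF assms] right_val_lincomb[OF assms] by (simp add: algebra_simps)

lemma jump_step: "jump t (step s) = (if t = s then 1 else 0)"
  by (auto simp: jump_def step_vals)

text \<open>The three conclusions share one induction, because the steps for the derivative and for
  the jumps use membership of the partial sum in \<open>GG I\<close>.\<close>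

lemma GG_sum:
  assumes "finite S" "\<And>j. j \<in> S \<Longrightarrow> h j \<in> GG I" "\<And>j. j \<in> S \<Longrightarrow> is_gderiv I (h j) (d j)"
  shows "(\<lambda>u. \<Sum>j\<in>S. c j * h j u) \<in> GG I \<and> is_gderiv I (\<lambda>u. \<Sum>j\<in>S. c j * h j u) (\<lambda>u. \<Sum>j\<in>S. c j * d j u)
    \<and> (\<forall>t\<in>I. jump t (\<lambda>u. \<Sum>j\<in>S. c j * h j u) = (\<Sum>j\<in>S. c j * jump t (h j)))"
  using assms
proof (induction S rule: finite_induct)
  case empty
  then show ?case using zero_GG is_gderiv_zero by (simp add: jump_def vals_const)
next
  case (insert a S)
  let ?g = "\<lambda>u. \<Sum>j\<in>S. c j * h j u"
  have IH: "?g \<in> GG I" "is_gderiv I ?g (\<lambda>u. \<Sum>j\<in>S. c j * d j u)"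
    "\<And>t. t \<in> I \<Longrightarrow> jump t ?g = (\<Sum>j\<in>S. c j * jump t (h j))"
    using insert by auto
  have a: "h a \<in> GG I" "is_gderiv I (h a) (d a)" using insert by auto
  show ?case
    using GG_lincomb[OF a(1) IH(1), of "c a" 1] insert(1,2) IH(3)
      is_gderiv_lincomb[OF a IH(1,2), of "c a" 1]
      jump_lincomb[OF a(1) IH(1), of _ "c a" 1]
    by auto
qed

text \<open>The function \<open>g\<close> is determined only almost everywhere, but its right values
  form a genuine function. In the absence of jumps this function is differentiable in the classical
  sense with derivative 0, hence constant on \<open>U\<close>, and \<open>g\<close> agrees with it
  almost everywhere.\<close>

lemma is_gderiv_0_AE_const:
  assumes "g \<in> GG I" "is_gderiv I g (\<lambda>_. 0)" "open U" "connected U" "U \<subseteq> I"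
    and jump: "\<And>t. t \<in> U \<Longrightarrow> jump t g = 0"
  shows "\<exists>k. AE t in lebesgue. t \<in> U \<longrightarrow> g t = k"
proof -
  let ?v = "right_val g"
  have lv: "left_val g t = ?v t" if "t \<in> U" for t using jump[OF that] by (simp add: jump_def)
  have D: "(?v has_derivative (\<lambda>h. 0)) (at t)" if t: "t \<in> U" for t
    unfolding has_derivative_at_alt
  proof (intro conjI bounded_linear_zero allI impI)
    fix e :: real assume "e > 0"
    have lim: "((\<lambda>s. (g s - ?v t) / complex_of_real (s - t)) \<longlongrightarrow> 0) (ess_at_left t)"
      "((\<lambda>s. (g s - ?v t) / complex_of_real (s - t)) \<longlongrightarrow> 0) (ess_at_right t)"
      using assms(2,5) t unfolding lv[OF t, symmetric] is_gderiv_def vals_const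
      by (metis lv subsetD)+
    obtain a where a: "a < t" "AE s in lebesgue. a < s \<longrightarrow> s < t \<longrightarrow> cmod ((g s - ?v t) / complex_of_real (s - t)) < e"
      using tendstoD[OF lim(1) \<open>e > 0\<close>] unfolding eventually_ess_at_left by auto
    obtain b where b: "t < b" "AE s in lebesgue. t < s \<longrightarrow> s < b \<longrightarrow> cmod ((g s - ?v t) / complex_of_real (s - t)) < e"
      using tendstoD[OF lim(2) \<open>e > 0\<close>] unfolding eventually_ess_at_right by auto
    obtain r where r: "r > 0" "ball t r \<subseteq> U" using assms(3) t by (rule openE)
    have "cmod (?v s - ?v t) \<le> e * \<bar>s - t\<bar>"
      if s: "s \<noteq> t" "\<bar>s - t\<bar> < r" "a < s" "s < b" for s
    proof -
      \<comment> \<open>The open side of \<open>t\<close> that contains \<open>s\<close>. The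
        estimate holds for almost every \<open>u\<close> there, and letting \<open>u\<close> tend to
        \<open>s\<close> from the right transfers it to the right value at \<open>s\<close>.\<close>
      let ?O = "if s < t then {a<..<t} else {t<..<b}"
      have "AE u in lebesgue. u \<in> ?O \<longrightarrow> cmod (g u - ?v t) \<le> e * \<bar>u - t\<bar>"
        using a(2) b(2) by eventually_elim (auto simp: norm_divide divide_simps simp flip: of_real_diff)
      then have "eventually (\<lambda>u. cmod (g u - ?v t) \<le> e * \<bar>u - t\<bar>) (ess_at_right s)"
        by (rule AE_eventually_ess_at(2)) (use s in auto)
      moreover have "s \<in> ball t r" using s(2) by (simp add: dist_real_def abs_minus_commute)
      then have "s \<in> I" using r(2) assms(5) by blast
      then have "((\<lambda>u. cmod (g u - ?v t)) \<longlongrightarrow> cmod (?v s - ?v t)) (ess_at_right s)"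
        by (intro tendsto_intros GG_tendsto_right[OF assms(1)])
      moreover have "((\<lambda>u. e * \<bar>u - t\<bar>) \<longlongrightarrow> e * \<bar>s - t\<bar>) (ess_at_right s)"
        by (rule tendsto_mono[OF ess_at_right_le]) (intro tendsto_intros)
      ultimately show ?thesis using tendsto_le[OF ess_at_right_not_bot] by blast
    qed
    then have "cmod (?v s - ?v t - 0) \<le> e * norm (s - t)"
      if "norm (s - t) < Min {r, t - a, b - t}" for s
      using that by (cases "s = t") auto
    moreover have "Min {r, t - a, b - t} > 0" using a b r by auto
    ultimately show "\<exists>d>0. \<forall>s. norm (s - t) < d \<longrightarrow> cmod (?v s - ?v t - 0) \<le> e * norm (s - t)"
      by blast
  qed
  have "?v constant_on U"
  proof (rule has_derivative_zero_connected_constant_on[OF assms(4,3), of "{}"])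
    show "continuous_on U ?v"
      using D by (meson continuous_at_imp_continuous_on has_derivative_continuous)
  qed (use D in \<open>auto intro: has_derivative_at_withinI\<close>)
  then obtain k where k: "\<And>t. t \<in> U \<Longrightarrow> ?v t = k" unfolding constant_on_def by blast
  \<comment> \<open>Both one-sided values of \<open>g\<close> equal \<open>k\<close> throughout
    \<open>U\<close>.\<close>
  have "AE t in lebesgue. t \<in> U \<longrightarrow> g t - k = 0"
  proof (rule ess_limits_0_imp_AE_0[OF assms(3)])
    fix t assume t: "t \<in> U"
    then have "t \<in> I" using assms(5) by blast
    then show "((\<lambda>s. g s - k) \<longlongrightarrow> 0) (ess_at_left t)" "((\<lambda>s. g s - k) \<longlongrightarrow> 0) (ess_at_right t)"
      using GG_tendsto_left[OF assms(1)] GG_tendsto_right[OF assms(1)] k[OF t] lv[OF t]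
      by (metis LIM_zero)+
  qed
  then show ?thesis by auto
qed

section \<open>Finiteness of the jump set and decomposition into steps\<close>

lemma jump_eq_0_if_continuous_on:
  assumes "open I" "ae_eq_on I g h" "open U" "U \<subseteq> I" "continuous_on U h" "t \<in> U"
  shows "jump t g = 0"
proof -
  have t: "t \<in> I" using assms by blast
  have *: "(h \<longlongrightarrow> h t) (at t)"
    using assms(3,5,6) by (metis continuous_on_eq_continuous_at isCont_def)
  have "left_val h t = h t" "right_val h t = h t"
    by (rule left_val_eqI[OF tendsto_mono[OF ess_at_left_le_at *]],
        rule right_val_eqI[OF tendsto_mono[OF ess_at_right_le_at *]])
  then show ?thesis using ae_eq_on_vals(3,4)[OF assms(1,2) t] by (simp add: jump_def)
qed

text \<open>Only for \<open>k = 0\<close> may the function itself jump, and then only in the locally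
  finite exceptional set; for other \<open>k\<close> it has a continuous representative.\<close>

lemma FF_k_jumps:
  assumes "open I" "g \<in> FF_k I k"
  obtains S where "\<And>K. compact K \<Longrightarrow> K \<subseteq> I \<Longrightarrow> finite (S \<inter> K)" "\<And>t. t \<in> I - S \<Longrightarrow> jump t g = 0"
proof (cases "k = 0")
  case True
  then have "is_PC I g" using assms(2) by (auto simp: FF_k_def)
  then obtain h S where h: "ae_eq_on I g h" "continuous_on (I - S) h"
    and S: "\<And>K. compact K \<Longrightarrow> K \<subseteq> I \<Longrightarrow> finite (S \<inter> K)"
    unfolding is_PC_def by blast
  have "jump t g = 0" if t: "t \<in> I - S" for t
  proof -
    obtain e where e: "e > 0" "cball t e \<subseteq> I" using assms(1) t open_contains_cball by blast
    \<comment> \<open>The closed ball is compact in \<open>I\<close>, so only finitely many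
      exceptional points are removed and an open neighbourhood of \<open>t\<close> remains.\<close>
    let ?U = "ball t e - S \<inter> cball t e"
    have sub: "?U \<subseteq> I - S" using e(2) ball_subset_cball by blast
    have "open ?U" using S[OF _ e(2)] by (intro open_Diff finite_imp_closed) auto
    moreover have "t \<in> ?U" using t e by auto
    ultimately show ?thesis
      using jump_eq_0_if_continuous_on[OF assms(1) h(1), of ?U t] continuous_on_subset[OF h(2) sub] sub
      by blast
  qed
  then show thesis using S that by blast
next
  case False
  then have "is_BC I g" using assms(2) by (force simp: FF_k_def)
  then obtain h where "ae_eq_on I g h" "continuous_on I h" unfolding is_BC_def by blast
  then have "jump t g = 0" if "t \<in> I" for t
    using that jump_eq_0_if_continuous_on[OF assms(1) _ assms(1)] by blast
  then show thesis using that[of "{}"] by auto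
qed

text \<open>A jump of \<phi> lies in its compact support and in the exceptional set of one of
  finitely many summands, each of which meets that support in a finite set.\<close>

lemma finite_jumps_RR_F:
  assumes "open I" "\<phi> \<in> RR_F I"
  shows "finite {t \<in> I. jump t \<phi> \<noteq> 0}"
proof -
  obtain n c h where h: "\<And>j. j < n \<Longrightarrow> h j \<in> (\<Union>k. FF_k I k)"
    and ae: "ae_eq_on I \<phi> (\<lambda>t. \<Sum>j<(n::nat). c j * h j t)"
    using assms(2) unfolding RR_F_def FF_def by blast
  have "\<exists>S. (\<forall>K. compact K \<longrightarrow> K \<subseteq> I \<longrightarrow> finite (S \<inter> K)) \<and> (\<forall>t\<in>I - S. jump t (h j) = 0)" if "j < n" for j
    using h[OF that] FF_k_jumps[OF assms(1)] by (metis UN_E)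
  then obtain S where S: "\<And>j K. j < n \<Longrightarrow> compact K \<Longrightarrow> K \<subseteq> I \<Longrightarrow> finite (S j \<inter> K)"
    "\<And>j t. j < n \<Longrightarrow> t \<in> I - S j \<Longrightarrow> jump t (h j) = 0"
    by metis
  have K: "compact (gsupp I \<phi>)" "gsupp I \<phi> \<subseteq> I" using assms(2) by (auto simp: RR_F_def RR_def gsupp_def)
  have "t \<in> (\<Union>j<n. S j \<inter> gsupp I \<phi>)" if t: "t \<in> I" "jump t \<phi> \<noteq> 0" for t
  proof -
    have "t \<in> {t \<in> I. left_val \<phi> t \<noteq> 0 \<or> right_val \<phi> t \<noteq> 0}" using t by (auto simp: jump_def)
    then have "t \<in> gsupp I \<phi>" unfolding gsupp_def by (intro IntI subsetD[OF closure_subset] t)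
    moreover have "\<exists>j<n. t \<in> S j"
    proof (rule ccontr)
      assume "\<not> (\<exists>j<n. t \<in> S j)"
      then have z: "jump t (h j) = 0" if "j < n" for j using S(2)[OF that] t(1) that by blast
      have G: "h j \<in> GG_inf I" if "j < n" for j using h[OF that] by (auto simp: FF_k_def)
      have "jump t (\<lambda>t. \<Sum>j<n. c j * h j t) = (\<Sum>j<n. c j * jump t (h j))"
        using GG_sum[of "{..<n}" h I "\<lambda>j. gderiv I (h j)" c] G GG_inf_is_gderiv[OF assms(1)] t(1)
        by (auto simp: GG_inf_def)
      also have "\<dots> = 0" using z by simp
      finally have "jump t \<phi> = 0" using ae_eq_on_vals(3,4)[OF assms(1) ae t(1)] by (simp add: jump_def)
      with t show False by simp
    qed
    ultimately show ?thesis by blast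
  qed
  moreover have "finite (\<Union>j<n. S j \<inter> gsupp I \<phi>)" using S(1) K by blast
  ultimately show ?thesis by (elim finite_subset[rotated]) blast
qed

text \<open>The point \<open>r\<close> cuts \<open>I\<close> into two open intervals, on each of
  which \<open>w\<close> is constant. Each of them extends beyond the compact interval carrying
  \<open>w\<close>, so both constants are 0.\<close>

lemma is_gderiv_0_AE_0_off:
  assumes "open I" "is_interval I" "r \<in> I" "w \<in> RR I" "is_gderiv I w (\<lambda>_. 0)"
    and jump: "\<And>t. t \<in> I \<Longrightarrow> t \<noteq> r \<Longrightarrow> jump t w = 0"
  shows "ae_eq_on I w (\<lambda>_. 0)"
proof -
  obtain c d where cd: "{c..d} \<subseteq> I" "w \<in> RR_on I {c..d}" "c \<le> r" "r \<le> d"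
    using assms(1-4) by (rule RR_on_Icc)
  have G: "w \<in> GG I" using assms(4) by (simp add: RR_def GG_inf_def)
  have zero: "AE t in lebesgue. t \<in> U \<longrightarrow> w t = 0"
    if U: "open U" "is_interval U" "U \<subseteq> I - {r}" and s: "s \<in> U" "s \<notin> {c..d}" for U s
  proof -
    obtain k where k: "AE t in lebesgue. t \<in> U \<longrightarrow> w t = k"
      using is_gderiv_0_AE_const[OF G assms(5) U(1)] U jump is_interval_connected by blast
    have "left_val w s = k"
      using left_val_cong[OF AE_eventually_ess_at(1)[OF k U(1) s(1)]] by (simp add: vals_const)
    moreover have "left_val w s = 0"
      using RR_on_vals_0(1)[OF assms(1) _ cd(2)] U s by auto
    ultimately show ?thesis using k by simp
  qed
  have "c \<in> I" "d \<in> I" using cd by auto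
  obtain e where e: "e > 0" "ball c e \<subseteq> I" using assms(1) \<open>c \<in> I\<close> by (rule openE)
  obtain e' where e': "e' > 0" "ball d e' \<subseteq> I" using assms(1) \<open>d \<in> I\<close> by (rule openE)
  \<comment> \<open>Openness of \<open>I\<close> supplies points just outside \<open>{c..d}\<close>,
    where the constants can be read off.\<close>
  have "c - e / 2 \<in> I" "d + e' / 2 \<in> I" using e e' by (auto simp: dist_real_def subset_iff)
  have "AE t in lebesgue. t \<in> I \<inter> {..<r} \<longrightarrow> w t = 0"
    using assms(1,2) \<open>c - e / 2 \<in> I\<close> e(1) cd
    by (intro zero[of _ "c - e / 2"] open_Int is_interval_Int) auto
  moreover have "AE t in lebesgue. t \<in> I \<inter> {r<..} \<longrightarrow> w t = 0"
    using assms(1,2) \<open>d + e' / 2 \<in> I\<close> e'(1) cd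
    by (intro zero[of _ "d + e' / 2"] open_Int is_interval_Int) auto
  moreover have "AE s in lebesgue. s \<noteq> r"
    using AE_not_in[of "{r}" lebesgue] by (simp add: null_sets_completionI)
  ultimately have "AE t in lebesgue. t \<in> I \<longrightarrow> w t = 0"
    by eventually_elim force
  then show ?thesis unfolding ae_eq_on_def AE_lebesgue_on_iff[OF assms(1)] .
qed

text \<open>The difference of the two sides is a test function with zero derivative whose jumps away
  from \<open>r\<close> cancel. At \<open>r\<close> the compact support decides, through
  \<open>is_gderiv_0_AE_0_off\<close>.\<close>

lemma jump_decomposition:
  assumes "open I" "is_interval I" "r \<in> I" "\<phi> \<in> RR I" and fin: "finite {t \<in> I. jump t \<phi> \<noteq> 0}"
  shows "ae_eq_on I (\<lambda>t. 1 * \<phi> t + (-1) * cut_primitive I r (gderiv I \<phi>) t)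
    (\<lambda>t. \<Sum>s\<in>{t \<in> I. jump t \<phi> \<noteq> 0}. jump s \<phi> * (step s t - step r t))"
proof -
  let ?S = "{t \<in> I. jump t \<phi> \<noteq> 0}" and ?P = "cut_primitive I r (gderiv I \<phi>)"
  let ?d = "\<lambda>t. 1 * \<phi> t + (-1) * ?P t" and ?j = "\<lambda>t. \<Sum>s\<in>?S. jump s \<phi> * (step s t - step r t)"
  let ?w = "\<lambda>t. 1 * ?d t + (-1) * ?j t"
  have G\<phi>: "\<phi> \<in> GG_inf I" "\<phi> \<in> GG I" using assms(4) by (auto simp: RR_def GG_inf_def)
  have D: "gderiv I \<phi> \<in> RR I" by (rule gderiv_RR[OF assms(1-4)])
  obtain c d where cd: "gderiv I \<phi> \<in> RR_on I {c..d}" "c \<le> r" "r \<le> d"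
    using assms(1-3) D by (rule RR_on_Icc)
  then have "c \<le> d" by simp
  note P = is_gderiv_cut_primitive[OF assms(1) cd(1) \<open>c \<le> d\<close>, of r]
  have d: "is_gderiv I ?d (\<lambda>_. 0)" "?d \<in> GG I"
    using is_gderiv_lincomb[OF G\<phi>(2) GG_inf_is_gderiv[OF assms(1) G\<phi>(1)] P(2,1), of 1 "-1"]
      GG_lincomb[OF G\<phi>(2) P(2), of 1 "-1"] by simp_all
  have H: "(\<lambda>t. step s t - step r t) \<in> GG I" "is_gderiv I (\<lambda>t. step s t - step r t) (\<lambda>_. 0)"
    "\<And>t. t \<in> I \<Longrightarrow> jump t (\<lambda>t. step s t - step r t) = jump t (step s) - jump t (step r)" for s
    using GG_lincomb[OF step_GG step_GG, of 1 s "-1" r I] jump_lincomb[OF step_GG step_GG, of _ I 1 s "-1" r]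
      is_gderiv_lincomb[OF step_GG is_gderiv_step step_GG is_gderiv_step, of I 1 s "-1" r] by simp_all
  have j: "?j \<in> GG I" "is_gderiv I ?j (\<lambda>_. 0)"
    "\<And>t. t \<in> I \<Longrightarrow> jump t ?j = (\<Sum>s\<in>?S. jump s \<phi> * (jump t (step s) - jump t (step r)))"
    using GG_sum[OF fin H(1,2), of "\<lambda>s. jump s \<phi>"] by (auto simp: H(3))
  have "ae_eq_on I ?w (\<lambda>_. 0)"
  proof (rule is_gderiv_0_AE_0_off[OF assms(1-3)])
    show "?w \<in> RR I"
      using step_diff_RR[OF assms(1-3)]
      by (intro RR_lincomb RR_sum assms cut_primitive_RR D) auto
    show "is_gderiv I ?w (\<lambda>_. 0)"
      using is_gderiv_lincomb[OF d(2,1) j(1,2), of 1 "-1"] by simp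
    fix t assume t: "t \<in> I" "t \<noteq> r"
    have "jump t ?w = jump t \<phi> - jump t ?j"
      using jump_lincomb[OF d(2) j(1) t(1), of 1 "-1"] jump_lincomb[OF G\<phi>(2) P(2) t(1), of 1 "-1"]
        jump_cut_primitive[OF assms(1) cd(1) \<open>c \<le> d\<close> t] by simp
    \<comment> \<open>As \<open>t\<close> differs from \<open>r\<close>, the step at
      \<open>r\<close> contributes no jump and only the summand with \<open>s = t\<close>
      survives.\<close>
    also have "jump t ?j = (\<Sum>s\<in>?S. if s = t then jump s \<phi> else 0)"
      unfolding j(3)[OF t(1)] using t by (intro sum.cong) (auto simp: jump_step)
    also have "\<dots> = jump t \<phi>" using fin t by (auto simp: sum.delta)
    finally show "jump t ?w = 0" by simp
  qed
  then show ?thesis unfolding ae_eq_on_def by (auto elim: eventually_mono)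
qed

section \<open>Construction of the solution\<close>

theorem theorem3p2:
  fixes a b :: ereal and I :: "real set" and t\<^sub>0 :: real
    and f :: "(real \<Rightarrow> complex) \<Rightarrow> complex"
  assumes "I = einterval a b"
    and "t\<^sub>0 \<in> I"
    and "f \<in> RR_dual I"
    and "vanishes_before I t\<^sub>0 f"
  shows "\<exists>x. x \<in> RR_dual I \<and> is_solution I f x \<and> vanishes_before I t\<^sub>0 x"
proof -
  have I: "open I" "is_interval I"
    unfolding assms(1) is_interval_1
    by simp (metis einterval_iff ereal_less_eq(3) le_less_trans less_le_trans)
  obtain e where e: "e > 0" "ball t\<^sub>0 e \<subseteq> I" using I(1) assms(2) by (rule openE)
  \<comment> \<open>Half the radius gives a point of \<open>I\<close> strictly to the left of
    \<open>t\<^sub>0\<close>.\<close>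
  define r where "r = t\<^sub>0 - e / 2"
  have r: "r \<in> I" "r < t\<^sub>0" using e by (auto simp: r_def dist_real_def subset_iff)
  define x where "x = (\<lambda>\<phi>. - f (cut_primitive I r \<phi>))"
  \<comment> \<open>This is \<open>f\<close> minus \<open>ddt I x\<close>, the plus sign coming from
    the minus in \<open>ddt\<close>. Hence \<open>f\<close> itself is a derivative of
    \<open>x\<close> as soon as \<delta> lies in \<open>Delta I\<close>.\<close>
  define \<delta> where "\<delta> = (\<lambda>\<phi>. f \<phi> + x (gderiv I \<phi>))"
  have x: "x \<in> RR_dual I"
    unfolding x_def by (intro RR_dual_minus RR_dual_comp_cut_primitive I r assms)
  have \<delta>: "\<delta> \<in> RR_dual I"
    unfolding \<delta>_def by (intro RR_dual_add assms RR_dual_comp_gderiv[OF I r(1)] x)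
  have "\<delta> \<phi> = (\<Sum>s\<in>{t \<in> I. jump t \<phi> \<noteq> 0}. f (\<lambda>t. step s t - step r t) * jump s \<phi>)"
    if "\<phi> \<in> RR_F I" for \<phi>
  proof -
    let ?S = "{t \<in> I. jump t \<phi> \<noteq> 0}" and ?P = "cut_primitive I r (gderiv I \<phi>)"
    have \<phi>: "\<phi> \<in> RR I" and fin: "finite ?S"
      using that finite_jumps_RR_F[OF I(1) that] by (auto simp: RR_F_def)
    have P: "?P \<in> RR I" by (intro cut_primitive_RR gderiv_RR[OF I r(1)] I r \<phi>)
    have H: "\<And>s. s \<in> ?S \<Longrightarrow> (\<lambda>t. step s t - step r t) \<in> RR I"
      using step_diff_RR[OF I r(1)] by simp
    have "\<delta> \<phi> = f (\<lambda>t. 1 * \<phi> t + (-1) * ?P t)"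
      unfolding \<delta>_def x_def RR_dual_lin[OF assms(3) \<phi> P] by simp
    also have "\<dots> = f (\<lambda>t. \<Sum>s\<in>?S. jump s \<phi> * (step s t - step r t))"
      using fin H by (intro RR_dual_ae[OF assms(3)] RR_lincomb \<phi> P RR_sum jump_decomposition I r(1))
    also have "\<dots> = (\<Sum>s\<in>?S. jump s \<phi> * f (\<lambda>t. step s t - step r t))"
      using H by (intro RR_dual_sum[OF assms(3) fin])
    finally show ?thesis by (simp add: mult.commute)
  qed
  then have "\<delta> \<in> Delta I"
    unfolding Delta_def using \<delta>
    by (intro CollectI conjI exI[of _ "\<lambda>s. f (\<lambda>t. step s t - step r t)"] ballI) auto
  then have "f \<in> derivatives I x"
    unfolding derivatives_def using assms(3) by (auto simp: ddt_def \<delta>_def intro!: bexI[of _ \<delta>])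
  then have "is_solution I f x" using x unfolding is_solution_def by blast
  moreover have "vanishes_before I t\<^sub>0 x"
    unfolding vanishes_before_def
  proof (intro ballI impI)
    fix \<phi> assume \<phi>: "\<phi> \<in> RR I" "gsupp I \<phi> \<subseteq> I \<inter> {..<t\<^sub>0}"
    obtain c d where cd: "d \<in> insert r (gsupp I \<phi>)" "\<phi> \<in> RR_on I {c..d}" "c \<le> r" "r \<le> d" "{c..d} \<subseteq> I"
      using I r(1) \<phi>(1) by (rule RR_on_Icc)
    have "gsupp I (cut_primitive I r \<phi>) \<subseteq> {c..d}"
      by (rule gsupp_subset_RR_on[OF I(1) closed_atLeastAtMost cut_primitive_RR_on[OF I(1) cd(2-4)]])
    \<comment> \<open>The right endpoint is either \<open>r\<close> or a support point of \<phi>,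
      and both lie before \<open>t\<^sub>0\<close>.\<close>
    moreover have "d < t\<^sub>0" using cd(1) \<phi>(2) r(2) by auto
    ultimately have "gsupp I (cut_primitive I r \<phi>) \<subseteq> I \<inter> {..<t\<^sub>0}" using cd(5) by force
    then show "x \<phi> = 0"
      using assms(4) cut_primitive_RR[OF I r(1) \<phi>(1)] by (simp add: vanishes_before_def x_def)
  qed
  ultimately show ?thesis using x by blast
qed

end
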